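(* Let $n\ge2$, $r\ge1$, $s\ge2$ be integers, let $p\ge9$ be odd, and put $t=rs$. If $$G\in\mathcal{GL}^1_r(s(p-n)+n,\,n)\;\cup\;\mathcal{GL}^2_r\big(s(p+2n-1)/2+(p-2n+1)/2,\,n\big)\;\cup\;\mathcal{GL}^3_r\big(s(p+1)/2+(p-1)/2,\,n\big),$$ where the three families are built from graphs in $\mathcal L_t(p,n)$, then $\chi_{la}(G)=3$.
   Context: Local antimagic chromatic number: for a graph $G=(V,E)$ (possibly disconnected, with no $K_2$ component) a bijection $f:E\to\{1,\dots,|E|\}$ is a local antimagic labeling if $f^+(u)\ne f^+(v)$ for every edge $uv\in E$, where $f^+(u)$ is the sum of $f(e)$ over all edges $e$ incident to $u$. $\chi_{la}(G)$ is the minimum, over all local antimagic labelings $f$ of $G$, of the number of distinct values of $f^+$ on $V$. Luv graphs: let $p\ge 9$ be odd and $n\ge2$. A Luv graph with parameters $(p,n)$ is a simple graph on $p$ vertices $u_1,\dots,u_p$ whose edge set is $\bigcup_{\phi=1}^n (E^\phi\cup F^\phi)$, where: (1) $E^1=\{u_iu_{i+1}: 1\le i\le p-1\}$; (2) for $2\le\phi\le n$, $E^\phi=\{u_{j^\phi_i}u_{j^\phi_{i+1}}:1\le i\le p-1\}$, where $(j^\phi_1,\dots,j^\phi_p)$ is a permutation of $\{1,\dots,p\}$ with $j^\phi_1=1$, $j^\phi_p=p$ and $|j^\phi_{i+1}-j^\phi_i|$ odd and $\ge 3$ for all $1\le i\le p-1$; moreover $E^\phi\cap E^{\phi'}=\varnothing$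 for $2\le\phi\ne\phi'\le n$; (3) $F^\phi=\{u_1u_{2a^\phi+1},\,u_pu_{2a^\phi+1}\}$ for $1\le\phi\le n$, where $a^1,\dots,a^n$ are pairwise distinct integers in $[1,\frac{p-3}{2}]$. In a Luv graph the vertex set splits into three independent classes: $S$, the $n$ vertices $u_{2a^\phi+1}$ of degree $2n+2$; $O$, the remaining $(p-2n+1)/2$ vertices with odd subscript (degree $2n$); and $Q$, the $(p-1)/2$ vertices with even subscript (degree $2n$). $\mathcal L_t(p,n)$ (also written $\mathcal{GL}_t(p,n)$) is the family of disjoint unions of $t$ Luv graphs with parameters $(p,n)$ (choices may differ between components). Merged families: let $t=rs$ with $r\ge1$, $s\ge2$. Take a graph in $\mathcal L_t(p,n)$ and partition its $t$ components into $r$ disjoint sets $D_1,\dots,D_r$ of $s$ components each. Merging vertices means identifying them to one vertex incident to all edges formerly incident to any of them. In each component order the vertices of the class under consideration. (a) $\mathcal{GL}^1_r(s(p-n)+n,n)$: graphs with $r$ components, the $\rho$-th one ($1\le\rho\le r$) obtained from $D_\rho$ by merging, for each $k\in[1,n]$, the $k$-th vertices of class $S$ of the $s$ components in $D_\rho$ into one vertex. (b) $\mathcal{GL}^2_r(s(p+2n-1)/2+(p-2n+1)/2,n)$: graphs with $r$ components, the $\rho$-th one obtained from $D_\rho$ by merging, for each $k\in[1,(p-2n+1)/2]$, the $k$-th vertices of class $O$ of the $s$ components in $D_\rho$ into one vertex. (c) $\mathcal{GL}^3_r(s(p+1)/2+(p-1)/2,n)$: graphs with $r$ components, the $\rho$-th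 one obtained from $D_\rho$ by merging, for each $k\in[1,(p-1)/2]$, the $k$-th vertices of class $Q$ of the $s$ components in $D_\rho$ into one vertex. In each case the first argument is the order of each component. *)

theory Defs
  imports Main "HOL-Library.Disjoint_Sets"
begin

type_synonym 'a graph = "'a set \<times> 'a set set"

abbreviation verts :: "'a graph \<Rightarrow> 'a set" where "verts \<equiv> fst"
abbreviation edges :: "'a graph \<Rightarrow> 'a set set" where "edges \<equiv> snd"

definition induced_label :: "'a graph \<Rightarrow> ('a set \<Rightarrow> nat) \<Rightarrow> 'a \<Rightarrow> nat" where
  "induced_label G f v = (\<Sum>e | e \<in> edges G \<and> v \<in> e. f e)"

definition local_antimagic :: "'a graph \<Rightarrow> ('a set \<Rightarrow> nat) \<Rightarrow> bool" where
  "local_antimagic G f \<longleftrightarrow>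
     bij_betw f (edges G) {1..card (edges G)} \<and>
     (\<forall>u v. {u, v} \<in> edges G \<longrightarrow> induced_label G f u \<noteq> induced_label G f v)"

definition chi_la :: "'a graph \<Rightarrow> nat" where
  "chi_la G = (LEAST k. \<exists>f. local_antimagic G f \<and> k = card (induced_label G f ` verts G))"

(* A presentation of a Luv graph: vert L i is u_i, perm L \<phi> i is j^\<phi>_i
   (only used for \<phi> \<ge> 2), apex L \<phi> is a^\<phi>. *)
record 'a luv =
  vert :: "nat \<Rightarrow> 'a"
  perm :: "nat \<Rightarrow> nat \<Rightarrow> nat"
  apex :: "nat \<Rightarrow> nat"

definition luv_E :: "nat \<Rightarrow> 'a luv \<Rightarrow> nat \<Rightarrow> 'a set set" where
  "luv_E p L \<phi> =
     (if \<phi> = 1 then {{vert L i, vert L (i + 1)} | i. i \<in> {1..p - 1}}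
      else {{vert L (perm L \<phi> i), vert L (perm L \<phi> (i + 1))} | i. i \<in> {1..p - 1}})"

definition luv_F :: "nat \<Rightarrow> 'a luv \<Rightarrow> nat \<Rightarrow> 'a set set" where
  "luv_F p L \<phi> =
     {{vert L 1, vert L (2 * apex L \<phi> + 1)}, {vert L p, vert L (2 * apex L \<phi> + 1)}}"

definition is_luv :: "nat \<Rightarrow> nat \<Rightarrow> 'a luv \<Rightarrow> bool" where
  "is_luv p n L \<longleftrightarrow>
     odd p \<and> p \<ge> 9 \<and> n \<ge> 2 \<and>
     inj_on (vert L) {1..p} \<and>
     (\<forall>\<phi>\<in>{2..n}.
        bij_betw (perm L \<phi>) {1..p} {1..p} \<and> perm L \<phi> 1 = 1 \<and> perm L \<phi> p = p \<and>
        (\<forall>i\<in>{1..p - 1}.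
           odd \<bar>int (perm L \<phi> (i + 1)) - int (perm L \<phi> i)\<bar> \<and>
           \<bar>int (perm L \<phi> (i + 1)) - int (perm L \<phi> i)\<bar> \<ge> 3)) \<and>
     (\<forall>\<phi>\<in>{2..n}. \<forall>\<phi>'\<in>{2..n}. \<phi> \<noteq> \<phi>' \<longrightarrow> luv_E p L \<phi> \<inter> luv_E p L \<phi>' = {}) \<and>
     inj_on (apex L) {1..n} \<and>
     (\<forall>\<phi>\<in>{1..n}. apex L \<phi> \<in> {1..(p - 3) div 2})"

definition luv_graph :: "nat \<Rightarrow> nat \<Rightarrow> 'a luv \<Rightarrow> 'a graph" where
  "luv_graph p n L = (vert L ` {1..p}, \<Union>\<phi>\<in>{1..n}. luv_E p L \<phi> \<union> luv_F p L \<phi>)"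

definition class_S :: "nat \<Rightarrow> nat \<Rightarrow> 'a luv \<Rightarrow> 'a set" where
  "class_S p n L = {vert L (2 * apex L \<phi> + 1) | \<phi>. \<phi> \<in> {1..n}}"

definition class_O :: "nat \<Rightarrow> nat \<Rightarrow> 'a luv \<Rightarrow> 'a set" where
  "class_O p n L = {vert L i | i. i \<in> {1..p} \<and> odd i} - class_S p n L"

definition class_Q :: "nat \<Rightarrow> nat \<Rightarrow> 'a luv \<Rightarrow> 'a set" where
  "class_Q p n L = {vert L i | i. i \<in> {1..p} \<and> even i}"

(* C 1, ..., C t present the t components of a member of L_t(p,n), whose graph is
   luv_union_graph t p n C. *)
definition luv_union :: "nat \<Rightarrow> nat \<Rightarrow> nat \<Rightarrow> (nat \<Rightarrow> 'a luv) \<Rightarrow> bool" where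
  "luv_union t p n C \<longleftrightarrow>
     (\<forall>c\<in>{1..t}. is_luv p n (C c)) \<and>
     disjoint_family_on (\<lambda>c. verts (luv_graph p n (C c))) {1..t}"

definition luv_union_graph :: "nat \<Rightarrow> nat \<Rightarrow> nat \<Rightarrow> (nat \<Rightarrow> 'a luv) \<Rightarrow> 'a graph" where
  "luv_union_graph t p n C =
     (\<Union>c\<in>{1..t}. verts (luv_graph p n (C c)), \<Union>c\<in>{1..t}. edges (luv_graph p n (C c)))"

definition component_partition :: "nat \<Rightarrow> nat \<Rightarrow> (nat \<Rightarrow> nat set) \<Rightarrow> bool" where
  "component_partition r s D \<longleftrightarrow>
     (\<Union>\<rho>\<in>{1..r}. D \<rho>) = {1..r * s} \<and> disjoint_family_on D {1..r} \<and>
     (\<forall>\<rho>\<in>{1..r}. card (D \<rho>) = s)"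

(* Quotient graph: the vertices are the equivalence classes of R. As a set of edges it would
   collapse parallel edges; none arise in the families below, since only vertices of one
   independent class are identified, and never two vertices of the same component. *)
definition merge :: "('a \<times> 'a) set \<Rightarrow> 'a graph \<Rightarrow> 'a set graph" where
  "merge R G = (verts G // R, {{R `` {x}, R `` {y}} | x y. {x, y} \<in> edges G})"

(* ord c k is the k-th of the m vertices of the chosen class in component c. *)
definition merge_rel ::
    "nat \<Rightarrow> nat \<Rightarrow> (nat \<Rightarrow> nat set) \<Rightarrow> (nat \<Rightarrow> nat \<Rightarrow> 'a) \<Rightarrow> 'a set \<Rightarrow> ('a \<times> 'a) set" where
  "merge_rel r m D ord V = Id_on V \<union>
     {(ord c k, ord c' k) | c c' k. k \<in> {1..m} \<and> (\<exists>\<rho>\<in>{1..r}. c \<in> D \<rho> \<and> c' \<in> D \<rho>)}"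

definition merged_family ::
    "('a luv \<Rightarrow> 'a set) \<Rightarrow> nat \<Rightarrow> nat \<Rightarrow> nat \<Rightarrow> nat \<Rightarrow> nat \<Rightarrow> 'a set graph set" where
  "merged_family cls m r s p n =
     {merge (merge_rel r m D ord (verts H)) H | C D ord H.
        luv_union (r * s) p n C \<and> H = luv_union_graph (r * s) p n C \<and>
        component_partition r s D \<and>
        (\<forall>c\<in>{1..r * s}. bij_betw (ord c) {1..m} (cls (C c)))}"

(* The families are indexed by (r, s, p, n); in the usual notation the order of each component,
   given in the comments, replaces s and p. *)

(* order s(p - n) + n *)
definition GL1 :: "nat \<Rightarrow> nat \<Rightarrow> nat \<Rightarrow> nat \<Rightarrow> 'a set graph set" where
  "GL1 r s p n = merged_family (class_S p n) n r s p n"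

(* order s(p + 2n - 1)/2 + (p - 2n + 1)/2; the truncated subtraction below is exact, because
   n distinct values a^\<phi> in [1, (p - 3)/2] force 2n + 3 \<le> p *)
definition GL2 :: "nat \<Rightarrow> nat \<Rightarrow> nat \<Rightarrow> nat \<Rightarrow> 'a set graph set" where
  "GL2 r s p n = merged_family (class_O p n) ((p + 1 - 2 * n) div 2) r s p n"

(* order s(p + 1)/2 + (p - 1)/2 *)
definition GL3 :: "nat \<Rightarrow> nat \<Rightarrow> nat \<Rightarrow> nat \<Rightarrow> 'a set graph set" where
  "GL3 r s p n = merged_family (class_Q p n) ((p - 1) div 2) r s p n"

end

theory Submission imports Defs begin

text \<open>
  For each \<open>\<phi>\<close> the edges in \<open>E\<^sup>\<phi> \<union> F\<^sup>\<phi>\<close> form a closed trail with \<open>p + 1\<close> edges that runs along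
  \<open>E\<^sup>\<phi>\<close> from \<open>u\<^sub>1\<close> to \<open>u\<^sub>p\<close> and returns through the vertex of class \<open>S\<close> given by \<open>a\<^sup>\<phi>\<close>. Number the
  \<open>N = tn\<close> trails of all components by \<open>x = 1, \<dots>, N\<close>. Along trail \<open>x\<close> the edges in odd
  positions get the labels \<open>x, x + N, x + 2N, \<dots>\<close>, and those in even positions get
  decreasing labels such that consecutive labels add up to \<open>A = Np + 1\<close> at a vertex of
  class \<open>Q\<close>, to \<open>B = N(p + 1) + 1\<close> at a vertex of odd subscript on the path, and to
  \<open>B + N(p - 1)/2\<close> at the extra visit to the vertex of class \<open>S\<close>. Hence the induced label is
  constant on each class, and merging \<open>s\<close> vertices of one class multiplies the value of that class
  by \<open>s\<close>, which keeps the three values distinct. Conversely, an odd cycle of a Luv graph remains an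
  odd closed walk after merging, so three values are necessary.
\<close>

section \<open>Labels along the trails\<close>

text \<open>
  The edge in position \<open>i\<close> of every trail takes its label from the block
  \<open>Nb + 1, \<dots>, Nb + N\<close>, where \<open>b\<close> is the number below; the blocks are traversed upwards in odd
  positions and downwards in even positions, except that the last position gets the top block.
\<close>

definition block :: "nat \<Rightarrow> nat \<Rightarrow> nat" where
  "block p i = (if odd i then i div 2 else if i = Suc p then p else p - i div 2)"

definition trail_label :: "nat \<Rightarrow> nat \<Rightarrow> nat \<Rightarrow> nat \<Rightarrow> nat" where
  "trail_label N p x i = N * block p i + (if odd i then x else Suc N - x)"

text \<open>The edge in position \<open>i\<close> leaves the \<open>i\<close>-th vertex of the
  closed trail; the edge in position \<open>cyc_pred p i\<close> arrives there.\<close>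

definition cyc_pred :: "nat \<Rightarrow> nat \<Rightarrow> nat" where
  "cyc_pred p i = (if i = 1 then Suc p else i - 1)"

text \<open>As \<open>p + 1\<close> is even, parities alternate around the whole closed trail, so
  \<open>x\<close> and \<open>Suc N - x\<close> meet at every turn and add up to
  \<open>N + 1\<close>. The two blocks add up to \<open>p\<close> at odd \<open>i\<close> and to
  \<open>p - 1\<close> at even \<open>i\<close>.\<close>

lemma trail_label_turn:
  assumes "odd p" "x \<in> {1..N}" "i \<in> {1..p}"
  shows "trail_label N p x i + trail_label N p x (cyc_pred p i) =
         (if odd i then N * (p + 1) + 1 else N * p + 1)"
proof -
  consider "i = 1" | "odd i" "i \<noteq> 1" | "even i" by blast
  then show ?thesis
  proof cases
    case 1
    \<comment> \<open>The predecessor is position \<open>p + 1\<close>, whose exceptional block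
      \<open>p\<close> pairs with block \<open>0\<close>, as \<open>p - k\<close> pairs with
      \<open>k\<close> at the other odd positions.\<close>
    then show ?thesis using assms by (auto simp: trail_label_def cyc_pred_def block_def)
  next
    case 2
    then obtain k where k: "i = 2 * k + 1" by (auto elim: oddE)
    with 2 assms have kp: "k \<ge> 1" "k \<le> p" by auto
    have "trail_label N p x i = N * k + x"
      "trail_label N p x (cyc_pred p i) = N * (p - k) + (Suc N - x)"
      using assms 2 k kp by (auto simp: trail_label_def cyc_pred_def block_def)
    moreover have "N * k + N * (p - k) = N * p" using kp by (simp add: distrib_left[symmetric])
    ultimately show ?thesis using assms 2 by simp
  next
    case 3
    then obtain k where k: "i = 2 * k" by (auto elim: evenE)
    with 3 assms have kp: "k \<ge> 1" "k \<le> p" "i \<noteq> 1" "i \<noteq> Suc p" by auto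
    have *: "(i - Suc 0) div 2 = k - 1" using k kp by auto
    have "trail_label N p x i = N * (p - k) + (Suc N - x)"
      "trail_label N p x (cyc_pred p i) = N * (k - 1) + x"
      using assms 3 k kp * by (auto simp: trail_label_def cyc_pred_def block_def)
    moreover have "N * (k - 1) + N * (p - k) + N = N * (k - 1 + (p - k) + 1)"
      by (simp only: distrib_left mult_1_right)
    moreover have "k - 1 + (p - k) + 1 = p" using kp by simp
    ultimately show ?thesis using assms 3 by simp
  qed
qed

text \<open>The top block \<open>p\<close> meets the block \<open>p div 2\<close> of position
  \<open>p\<close>, which puts this sum above that of the other odd turns.\<close>

lemma trail_label_last:
  assumes "odd p" "x \<in> {1..N}"
  shows "trail_label N p x (Suc p) + trail_label N p x (cyc_pred p (Suc p)) =
         N * (p + 1) + 1 + N * (p div 2)"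
  using assms odd_pos[OF assms(1)] by (auto simp: trail_label_def cyc_pred_def block_def)

text \<open>Odd positions run up through \<open>0, ..., p div 2\<close>, even positions below
  \<open>p + 1\<close> run down through \<open>p - 1, ..., p div 2 + 1\<close>, and position
  \<open>p + 1\<close> takes the remaining value \<open>p\<close>.\<close>

lemma block_inj_on:
  assumes "odd p" shows "inj_on (block p) {1..Suc p}"
proof -
  obtain q where q: "p = 2 * q + 1" using assms by (auto elim: oddE)
  show ?thesis unfolding inj_on_def block_def q
    by (auto elim!: oddE evenE split: if_splits)
qed

lemma block_le: "odd p \<Longrightarrow> i \<in> {1..Suc p} \<Longrightarrow> block p i \<le> p"
  by (auto simp: block_def)

text \<open>Division by \<open>N\<close> recovers the block and the offset from a label, and these
  determine \<open>i\<close> and \<open>x\<close>. Surjectivity follows by counting.\<close>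

lemma trail_label_bij:
  assumes "odd p"
  shows "bij_betw (\<lambda>(x, i). trail_label N p x i) ({1..N} \<times> {1..Suc p}) {1..N * Suc p}"
proof -
  have eq: "b = b' \<and> y = y'"
    if "N * b + y = N * b' + y'" "y \<in> {1..N}" "y' \<in> {1..N}" for b b' y y'
  proof -
    \<comment> \<open>Offsets start at 1, so they are lowered by one to become remainders below
      \<open>N\<close>.\<close>
    have "(N * c + (z - 1)) div N = c" if "z \<in> {1..N}" for c z
      using that by (subst div_mult_self4) auto
    then have "(N * b + (y - 1)) div N = b" "(N * b' + (y' - 1)) div N = b'" using that by blast+
    moreover have "N * b + (y - 1) = N * b' + (y' - 1)" using that by auto
    ultimately have "b = b'" by simp
    with that show ?thesis by simp
  qed
  have inj: "inj_on (\<lambda>(x, i). trail_label N p x i) ({1..N} \<times> {1..Suc p})"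
  proof (rule inj_onI, clarify)
    fix x i x' i'
    assume a: "x \<in> {1..N}" "i \<in> {1..Suc p}" "x' \<in> {1..N}" "i' \<in> {1..Suc p}"
      and e: "trail_label N p x i = trail_label N p x' i'"
    have "block p i = block p i' \<and> (if odd i then x else Suc N - x) = (if odd i' then x' else Suc N - x')"
      by (rule eq) (use a e in \<open>auto simp: trail_label_def\<close>)
    moreover from this have "i = i'" using block_inj_on[OF assms] a by (auto dest: inj_onD)
    ultimately show "x = x' \<and> i = i'" using a by (auto split: if_splits)
  qed
  have "trail_label N p x i \<in> {1..N * Suc p}" if "x \<in> {1..N}" "i \<in> {1..Suc p}" for x i
  proof -
    have "N * block p i \<le> N * p" using block_le[OF assms that(2)] by (rule mult_le_mono2)
    moreover have "trail_label N p x i > N * block p i" "trail_label N p x i \<le> N * block p i + N"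
      using that by (auto simp: trail_label_def)
    ultimately show ?thesis by (simp only: atLeastAtMost_iff mult_Suc_right) linarith
  qed
  then have "(\<lambda>(x, i). trail_label N p x i) ` ({1..N} \<times> {1..Suc p}) \<subseteq> {1..N * Suc p}" by auto
  moreover have "card ((\<lambda>(x, i). trail_label N p x i) ` ({1..N} \<times> {1..Suc p})) = N * Suc p"
    by (subst card_image[OF inj]) simp
  ultimately have "(\<lambda>(x, i). trail_label N p x i) ` ({1..N} \<times> {1..Suc p}) = {1..N * Suc p}"
    by (intro card_subset_eq) auto
  with inj show ?thesis by (simp add: bij_betw_def)
qed

subsection \<open>Trails and classes of a Luv graph\<close>

text \<open>
  The path \<open>E\<^sup>\<phi>\<close> is closed up to a trail of length \<open>p + 1\<close>: position \<open>p + 1\<close> is the subscript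
  \<open>2a\<^sup>\<phi> + 1\<close> of the vertex of class \<open>S\<close>, and position \<open>p + 2\<close> is again \<open>1\<close>.
\<close>

definition trail :: "nat \<Rightarrow> 'a luv \<Rightarrow> nat \<Rightarrow> nat \<Rightarrow> nat" where
  "trail p L \<phi> i =
     (if i = Suc p then 2 * apex L \<phi> + 1 else if i = Suc (Suc p) then 1
      else if \<phi> = 1 then i else perm L \<phi> i)"

definition trail_edge :: "nat \<Rightarrow> 'a luv \<Rightarrow> nat \<Rightarrow> nat \<Rightarrow> 'a set" where
  "trail_edge p L \<phi> i = {vert L (trail p L \<phi> i), vert L (trail p L \<phi> (Suc i))}"

locale luv_pres =
  fixes p n :: nat and L :: "'a luv"
  assumes luv: "is_luv p n L"
begin

lemma odd_p: "odd p" and p_ge: "p \<ge> 9" and n_ge: "n \<ge> 2"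
  and inj_vert: "inj_on (vert L) {1..p}"
  and inj_apex: "inj_on (apex L) {1..n}"
  using luv by (auto simp: is_luv_def)

text \<open>The subscript of the vertex of class S thus lies between \<open>3\<close> and
  \<open>p - 2\<close>, apart from both ends of the path.\<close>

lemma apex_bounds:
  assumes "\<phi> \<in> {1..n}" shows "apex L \<phi> \<ge> 1" "2 * apex L \<phi> + 3 \<le> p"
proof -
  have "apex L \<phi> \<in> {1..(p - 3) div 2}" using luv assms by (auto simp: is_luv_def)
  then show "apex L \<phi> \<ge> 1" "2 * apex L \<phi> + 3 \<le> p" using p_ge by auto
qed

lemma trail_first: "\<phi> \<in> {1..n} \<Longrightarrow> trail p L \<phi> 1 = 1"
  and trail_p: "\<phi> \<in> {1..n} \<Longrightarrow> trail p L \<phi> p = p"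
  using luv p_ge by (auto simp: is_luv_def trail_def)

lemma trail_Suc_p: "trail p L \<phi> (Suc p) = 2 * apex L \<phi> + 1"
  and trail_Suc_Suc_p: "trail p L \<phi> (Suc (Suc p)) = 1"
  by (auto simp: trail_def)

lemma trail_bij: "\<phi> \<in> {1..n} \<Longrightarrow> bij_betw (trail p L \<phi>) {1..p} {1..p}"
proof (cases "\<phi> = 1")
  case True
  then have "bij_betw (trail p L \<phi>) {1..p} {1..p} = bij_betw (\<lambda>i. i) {1..p} {1..p}"
    by (intro bij_betw_cong) (auto simp: trail_def)
  then show ?thesis by (metis bij_betw_id_iff eq_id_iff)
next
  case False
  assume "\<phi> \<in> {1..n}"
  then have "bij_betw (perm L \<phi>) {1..p} {1..p}" using luv False by (auto simp: is_luv_def)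
  moreover have "bij_betw (trail p L \<phi>) {1..p} {1..p} = bij_betw (perm L \<phi>) {1..p} {1..p}"
    by (intro bij_betw_cong) (use False in \<open>auto simp: trail_def\<close>)
  ultimately show ?thesis by simp
qed

lemma trail_range:
  assumes "\<phi> \<in> {1..n}" "i \<in> {1..Suc (Suc p)}" shows "trail p L \<phi> i \<in> {1..p}"
proof (cases "i \<in> {1..p}")
  case True then show ?thesis using bij_betwE[OF trail_bij[OF assms(1)]] by blast
next
  case False
  then have "i = Suc p \<or> i = Suc (Suc p)" using assms by auto
  then show ?thesis using apex_bounds[OF assms(1)] p_ge by (auto simp: trail_def)
qed

text \<open>Parity will separate class Q from the other classes; the size of the gap will separate
  the edges of the first path from those of all others.\<close>

lemma trail_step:
  assumes "\<phi> \<in> {1..n}" "i \<in> {1..p - 1}"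
  shows "odd (trail p L \<phi> i + trail p L \<phi> (Suc i))"
    and "\<phi> \<noteq> 1 \<Longrightarrow> \<bar>int (trail p L \<phi> (Suc i)) - int (trail p L \<phi> i)\<bar> \<ge> 3"
    and "\<phi> = 1 \<Longrightarrow> \<bar>int (trail p L \<phi> (Suc i)) - int (trail p L \<phi> i)\<bar> = 1"
proof -
  have ip: "i \<noteq> p" "i \<noteq> Suc p" "i \<noteq> Suc (Suc p)" "i \<ge> 1" using assms by auto
  have st: "odd \<bar>int (perm L \<phi> (Suc i)) - int (perm L \<phi> i)\<bar> \<and>
     \<bar>int (perm L \<phi> (Suc i)) - int (perm L \<phi> i)\<bar> \<ge> 3" if "\<phi> \<noteq> 1"
  proof -
    have "\<phi> \<in> {2..n}" using that assms by auto
    then show ?thesis using luv assms(2) by (simp add: is_luv_def)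
  qed
  show "\<phi> \<noteq> 1 \<Longrightarrow> \<bar>int (trail p L \<phi> (Suc i)) - int (trail p L \<phi> i)\<bar> \<ge> 3"
   "\<phi> = 1 \<Longrightarrow> \<bar>int (trail p L \<phi> (Suc i)) - int (trail p L \<phi> i)\<bar> = 1"
    using st ip by (auto simp: trail_def)
  show "odd (trail p L \<phi> i + trail p L \<phi> (Suc i))"
  proof (cases "\<phi> = 1")
    case True then show ?thesis using ip by (auto simp: trail_def)
  next
    case False
    have "odd (int (perm L \<phi> (Suc i)) - int (perm L \<phi> i))" using st[OF False] by simp
    then have "odd (perm L \<phi> (Suc i) + perm L \<phi> i)" by auto
    then show ?thesis using ip False by (auto simp: trail_def)
  qed
qed

text \<open>Every path starts at \<open>1\<close> and each step flips the parity. So the case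
  distinction in \<open>trail_label_turn\<close> is one on the subscript of the vertex.\<close>

lemma trail_parity:
  assumes "\<phi> \<in> {1..n}" "i \<in> {1..p}" shows "odd (trail p L \<phi> i) = odd i"
proof -
  have "1 \<le> i" using assms by simp
  then have "i \<le> p \<longrightarrow> odd (trail p L \<phi> i) = odd i"
  proof (induction i rule: dec_induct)
    case base then show ?case using trail_first assms by auto
  next
    case (step i)
    show ?case
    proof
      assume "Suc i \<le> p"
      then have "i \<in> {1..p - 1}" using step by auto
      then show "odd (trail p L \<phi> (Suc i)) = odd (Suc i)"
        using trail_step(1)[OF assms(1), of i] step by auto
    qed
  qed
  then show ?thesis using assms by simp
qed

lemma trail_neq:
  assumes "\<phi> \<in> {1..n}" "i \<in> {1..Suc p}" shows "trail p L \<phi> i \<noteq> trail p L \<phi> (Suc i)"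
proof -
  consider "i \<in> {1..p - 1}" | "i = p" | "i = Suc p" using assms by force
  then show ?thesis
  proof cases
    case 1 then show ?thesis using trail_step(1)[OF assms(1), of i] by auto
  next
    case 2 then show ?thesis using trail_p trail_Suc_p apex_bounds assms by fastforce
  next
    case 3 then show ?thesis using trail_Suc_p trail_Suc_Suc_p apex_bounds assms by fastforce
  qed
qed

lemma luv_E_eq: "luv_E p L \<phi> = trail_edge p L \<phi> ` {1..p - 1}"
proof -
  have "trail_edge p L \<phi> ` {1..p - 1} =
    (\<lambda>i. if \<phi> = 1 then {vert L i, vert L (i + 1)}
         else {vert L (perm L \<phi> i), vert L (perm L \<phi> (i + 1))}) ` {1..p - 1}"
    by (rule image_cong) (auto simp: trail_edge_def trail_def)
  then show ?thesis by (auto simp: luv_E_def)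
qed

lemma luv_F_eq:
  assumes "\<phi> \<in> {1..n}" shows "luv_F p L \<phi> = trail_edge p L \<phi> ` {p, Suc p}"
  using trail_p[OF assms] trail_Suc_p trail_Suc_Suc_p
  by (auto simp: luv_F_def trail_edge_def)

lemma edges_eq:
  "edges (luv_graph p n L) = (\<lambda>(\<phi>, i). trail_edge p L \<phi> i) ` ({1..n} \<times> {1..Suc p})"
proof -
  have "{1..Suc p} = {1..p - 1} \<union> {p, Suc p}" using p_ge by auto
  then have "luv_E p L \<phi> \<union> luv_F p L \<phi> = trail_edge p L \<phi> ` {1..Suc p}" if "\<phi> \<in> {1..n}" for \<phi>
    using luv_E_eq[of \<phi>] luv_F_eq[OF that] by (simp add: image_Un)
  then show ?thesis by (auto simp: luv_graph_def)
qed

text \<open>Parity tells path edges from return edges. Path edges of different trails are separated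
  by the gap or by the disjointness assumed for \<open>\<phi> \<ge> 2\<close>, return edges by their
  apex and their other end.\<close>

lemma trail_edge_inj:
  "inj_on (\<lambda>(\<phi>, i). trail_edge p L \<phi> i) ({1..n} \<times> {1..Suc p})"
proof (rule inj_onI, clarify)
  fix \<phi> i \<psi> k
  assume a: "\<phi> \<in> {1..n}" "i \<in> {1..Suc p}" "\<psi> \<in> {1..n}" "k \<in> {1..Suc p}"
    and e: "trail_edge p L \<phi> i = trail_edge p L \<psi> k"
  let ?w = "trail p L"
  have r: "?w \<phi> i \<in> {1..p}" "?w \<phi> (Suc i) \<in> {1..p}" "?w \<psi> k \<in> {1..p}" "?w \<psi> (Suc k) \<in> {1..p}"
    using trail_range a by auto
  have img: "vert L ` {?w \<phi> i, ?w \<phi> (Suc i)} = vert L ` {?w \<psi> k, ?w \<psi> (Suc k)}"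
    using e by (simp add: trail_edge_def)
  have sub: "{?w \<phi> i, ?w \<phi> (Suc i)} \<subseteq> {1..p}" "{?w \<psi> k, ?w \<psi> (Suc k)} \<subseteq> {1..p}"
    using r by auto
  have "{?w \<phi> i, ?w \<phi> (Suc i)} = {?w \<psi> k, ?w \<psi> (Suc k)}"
    using inj_on_image_eq_iff[OF inj_vert sub] img by simp
  then have s: "?w \<phi> i = ?w \<psi> k \<and> ?w \<phi> (Suc i) = ?w \<psi> (Suc k) \<or>
    ?w \<phi> i = ?w \<psi> (Suc k) \<and> ?w \<phi> (Suc i) = ?w \<psi> k" by (auto simp: doubleton_eq_iff)
  \<comment> \<open>Path edges join opposite parities, return edges join two odd subscripts.\<close>
  have par: "odd (?w \<phi> i + ?w \<phi> (Suc i)) \<longleftrightarrow> i \<in> {1..p - 1}" if "\<phi> \<in> {1..n}" "i \<in> {1..Suc p}" for \<phi> i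
  proof (cases "i \<in> {1..p - 1}")
    case True then show ?thesis using trail_step that by auto
  next
    case False
    then have "i = p \<or> i = Suc p" using that by auto
    then show ?thesis using False trail_p trail_Suc_p trail_Suc_Suc_p that odd_p by auto
  qed
  have iff: "i \<in> {1..p - 1} \<longleftrightarrow> k \<in> {1..p - 1}" using par[OF a(1,2)] par[OF a(3,4)] s by (auto simp: add.commute)
  show "\<phi> = \<psi> \<and> i = k"
  proof (cases "i \<in> {1..p - 1}")
    case True
    then have k: "k \<in> {1..p - 1}" using iff by simp
    have "\<phi> = \<psi>"
    proof (rule ccontr)
      assume ne: "\<phi> \<noteq> \<psi>"
      show False
      proof (cases "\<phi> = 1 \<or> \<psi> = 1")
        case t: True
        show False using trail_step(2,3)[OF a(1) True] trail_step(2,3)[OF a(3) k] s ne t by auto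
      next
        case False
        then have "\<phi> \<in> {2..n}" "\<psi> \<in> {2..n}" using a by auto
        then have "luv_E p L \<phi> \<inter> luv_E p L \<psi> = {}" using luv ne by (auto simp: is_luv_def)
        then show False using e True k luv_E_eq by blast
      qed
    qed
    moreover have "i = k"
    proof -
      have inj: "?w \<phi> a = ?w \<phi> b \<longleftrightarrow> a = b" if "a \<in> {1..p}" "b \<in> {1..p}" for a b
        using trail_bij[OF a(1)] that by (auto simp: bij_betw_def inj_on_eq_iff)
      \<comment> \<open>A match with reversed ends would need \<open>i = Suc k\<close> and
        \<open>k = Suc i\<close> at once.\<close>
      have "i = k \<or> i = Suc k \<and> Suc i = k"
        using s \<open>\<phi> = \<psi>\<close> True k inj[of i k] inj[of i "Suc k"] inj[of "Suc i" k]
        by fastforce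
      then show ?thesis by linarith
    qed
    ultimately show ?thesis by simp
  next
    case False
    then have i: "i = p \<or> i = Suc p" and k: "k = p \<or> k = Suc p" using iff a by auto
    have ap: "2 * apex L \<phi> + 1 \<notin> {1, p}" "2 * apex L \<psi> + 1 \<notin> {1, p}" using apex_bounds a by fastforce+
    \<comment> \<open>An apex is neither \<open>1\<close> nor \<open>p\<close>, so apexes are
      matched with each other, and the other end tells position \<open>p\<close> from
      \<open>Suc p\<close>.\<close>
    have "apex L \<phi> = apex L \<psi> \<and> i = k"
      using i k s ap trail_p[OF a(1)] trail_p[OF a(3)] trail_Suc_p[of \<phi>] trail_Suc_p[of \<psi>]
        trail_Suc_Suc_p[of \<phi>] trail_Suc_Suc_p[of \<psi>] p_ge
      by auto
    then show ?thesis using inj_apex a by (auto dest: inj_onD)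
  qed
qed

text \<open>Each visit of the trail to \<open>j\<close> contributes the labels of the arriving and
  the departing edge. The path visits every subscript once; position \<open>p + 1\<close> is a
  second visit to the apex.\<close>

lemma trail_weight:
  assumes "\<phi> \<in> {1..n}" "j \<in> {1..p}" "x \<in> {1..N}"
  shows "(\<Sum>i\<in>{1..Suc p}. if vert L j \<in> trail_edge p L \<phi> i then trail_label N p x i else 0) =
    (if odd j then N * (p + 1) + 1 else N * p + 1) +
    (if j = 2 * apex L \<phi> + 1 then N * (p + 1) + 1 + N * (p div 2) else 0)"
proof -
  let ?w = "trail p L \<phi>" and ?l = "trail_label N p x"
  have mem: "vert L j \<in> trail_edge p L \<phi> i \<longleftrightarrow> j = ?w i \<or> j = ?w (Suc i)" if "i \<in> {1..Suc p}" for i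
    using inj_on_eq_iff[OF inj_vert assms(2) trail_range[OF assms(1), of i]]
      inj_on_eq_iff[OF inj_vert assms(2) trail_range[OF assms(1), of "Suc i"]] that
    by (auto simp: trail_edge_def)
  \<comment> \<open>The trail has no loops, so at most one of the two summands on the right is
    nonzero.\<close>
  have "(\<Sum>i\<in>{1..Suc p}. if vert L j \<in> trail_edge p L \<phi> i then ?l i else 0) =
     (\<Sum>i\<in>{1..Suc p}. (if ?w i = j then ?l i else 0) + (if ?w (Suc i) = j then ?l i else 0))"
    by (rule sum.cong[OF refl]) (simp add: mem trail_neq[OF assms(1)], use trail_neq[OF assms(1)] in fastforce)
  also have "\<dots> = (\<Sum>i\<in>{1..Suc p}. if ?w i = j then ?l i else 0) +
                  (\<Sum>i\<in>{1..Suc p}. if ?w (Suc i) = j then ?l i else 0)"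
    by (rule sum.distrib)
  \<comment> \<open>An arriving edge is now counted at the position it leads to; position
    \<open>p + 2\<close> wraps around to \<open>1\<close>.\<close>
  also have "(\<Sum>i\<in>{1..Suc p}. if ?w (Suc i) = j then ?l i else 0) =
             (\<Sum>i\<in>{1..Suc p}. if ?w i = j then ?l (cyc_pred p i) else 0)"
  proof -
    have "(\<Sum>i\<in>{1..Suc p}. if ?w (Suc i) = j then ?l i else 0) =
       (\<Sum>i\<in>{1..p}. if ?w (Suc i) = j then ?l i else 0) + (if ?w 1 = j then ?l (Suc p) else 0)"
      using trail_first[OF assms(1)] trail_Suc_Suc_p by simp
    also have "(\<Sum>i\<in>{1..p}. if ?w (Suc i) = j then ?l i else 0) =
       (\<Sum>i\<in>{Suc 1..Suc p}. if ?w i = j then ?l (cyc_pred p i) else 0)"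
      by (subst sum.shift_bounds_cl_Suc_ivl) (rule sum.cong, auto simp: cyc_pred_def)
    also have "\<dots> + (if ?w 1 = j then ?l (Suc p) else 0) =
       (\<Sum>i\<in>{1..Suc p}. if ?w i = j then ?l (cyc_pred p i) else 0)"
      by (subst (2) sum.atLeast_Suc_atMost) (auto simp: cyc_pred_def)
    finally show ?thesis .
  qed
  also have "(\<Sum>i\<in>{1..Suc p}. if ?w i = j then ?l i else 0) + \<dots> =
      (\<Sum>i\<in>{1..Suc p}. if ?w i = j then ?l i + ?l (cyc_pred p i) else 0)"
    by (subst sum.distrib[symmetric]) (rule sum.cong, auto)
  also have "\<dots> = (\<Sum>i\<in>{1..p}. if ?w i = j then ?l i + ?l (cyc_pred p i) else 0) +
      (if ?w (Suc p) = j then ?l (Suc p) + ?l (cyc_pred p (Suc p)) else 0)"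
    by simp
  also have "(\<Sum>i\<in>{1..p}. if ?w i = j then ?l i + ?l (cyc_pred p i) else 0) =
      (if odd j then N * (p + 1) + 1 else N * p + 1)"
  proof -
    have "?w ` {1..p} = {1..p}" and inj: "inj_on ?w {1..p}"
      using trail_bij[OF assms(1)] by (auto simp: bij_betw_def)
    then obtain k where k: "k \<in> {1..p}" "?w k = j" using assms(2) by (metis imageE)
    have "(\<Sum>i\<in>{1..p}. if ?w i = j then ?l i + ?l (cyc_pred p i) else 0) =
      (\<Sum>i\<in>{1..p}. if i = k then ?l i + ?l (cyc_pred p i) else 0)"
      by (rule sum.cong) (use k inj in \<open>auto dest: inj_onD\<close>)
    also have "\<dots> = ?l k + ?l (cyc_pred p k)" using k by simp
    also have "\<dots> = (if odd j then N * (p + 1) + 1 else N * p + 1)"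
      using trail_label_turn[OF odd_p assms(3) k(1)] trail_parity[OF assms(1) k(1)] k by simp
    finally show ?thesis .
  qed
  finally show ?thesis
    using trail_Suc_p[of \<phi>] trail_label_last[OF odd_p assms(3)] by auto
qed

end

subsection \<open>Labelings of quotient graphs\<close>

text \<open>By \<open>inj\<close> no two edges collapse, so \<open>g\<close> carries over to the
  quotient. No edge has two equivalent ends, so each edge at a merged vertex meets exactly one
  member of the class, and the induced labels add up.\<close>

lemma merge_labeling:
  fixes H :: "'a graph"
  assumes finV: "finite (verts H)" and fin: "finite (edges H)" and R: "equiv (verts H) R"
    and E: "\<And>e. e \<in> edges H \<Longrightarrow> \<exists>x y. e = {x, y} \<and> x \<in> verts H \<and> y \<in> verts H \<and> (x, y) \<notin> R"
    and inj: "inj_on ((`) (\<lambda>x. R `` {x})) (edges H)"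
    and g: "bij_betw g (edges H) {1..card (edges H)}"
  obtains f where "bij_betw f (edges (merge R H)) {1..card (edges (merge R H))}"
    "\<And>x. x \<in> verts H \<Longrightarrow>
       induced_label (merge R H) f (R `` {x}) = (\<Sum>y\<in>R `` {x}. induced_label H g y)"
proof
  let ?q = "\<lambda>x. R `` {x}"
  let ?Q = "(`) ?q"
  let ?f = "g \<circ> inv_into (edges H) ?Q"
  have edges: "edges (merge R H) = ?Q ` edges H"
  proof (rule set_eqI, rule iffI)
    fix e' assume "e' \<in> edges (merge R H)"
    then obtain x y where "e' = ?Q {x, y}" "{x, y} \<in> edges H" by (auto simp: merge_def)
    then show "e' \<in> ?Q ` edges H" by blast
  next
    fix e' assume "e' \<in> ?Q ` edges H"
    then obtain e where e: "e \<in> edges H" "e' = ?Q e" by blast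
    then obtain x y where "e = {x, y}" using E by blast
    with e show "e' \<in> edges (merge R H)" by (auto simp: merge_def)
  qed
  have bij: "bij_betw ?Q (edges H) (edges (merge R H))"
    using inj edges by (simp add: bij_betw_def)
  show "bij_betw ?f (edges (merge R H)) {1..card (edges (merge R H))}"
    using bij_betw_trans[OF bij_betw_inv_into[OF bij] g] bij_betw_same_card[OF bij] by simp
  fix x assume x: "x \<in> verts H"
  have sub: "e \<subseteq> verts H" if "e \<in> edges H" for e using E[OF that] by auto
  have q: "?q x = ?q y \<longleftrightarrow> y \<in> ?q x" if "y \<in> verts H" for y
    using eq_equiv_class_iff[OF R x that] by simp
  have qV: "?q x \<subseteq> verts H" using R by (auto simp: equiv_def refl_on_def)
  have "induced_label (merge R H) ?f (?q x) = (\<Sum>e' | e' \<in> ?Q ` edges H \<and> ?q x \<in> e'. ?f e')"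
    by (simp add: induced_label_def edges)
  also have "{e'. e' \<in> ?Q ` edges H \<and> ?q x \<in> e'} = ?Q ` {e \<in> edges H. ?q x \<in> ?Q e}" by auto
  also have "(\<Sum>e'\<in>\<dots>. ?f e') = (\<Sum>e | e \<in> edges H \<and> ?q x \<in> ?Q e. ?f (?Q e))"
    by (rule sum.reindex_cong[OF inj_on_subset[OF inj]]) auto
  also have "\<dots> = (\<Sum>e | e \<in> edges H \<and> ?q x \<in> ?Q e. g e)"
    by (rule sum.cong) (auto simp: inv_into_f_f[OF inj])
  also have "{e \<in> edges H. ?q x \<in> ?Q e} = (\<Union>y\<in>?q x. {e \<in> edges H. y \<in> e})"
  proof (intro set_eqI)
    fix e
    have "?q x \<in> ?Q e \<longleftrightarrow> (\<exists>y\<in>?q x. y \<in> e)" if "e \<in> edges H"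
      using q sub[OF that] by blast
    then show "e \<in> {e \<in> edges H. ?q x \<in> ?Q e} \<longleftrightarrow> e \<in> (\<Union>y\<in>?q x. {e \<in> edges H. y \<in> e})"
      by blast
  qed
  also have "sum g \<dots> = (\<Sum>y\<in>?q x. induced_label H g y)"
  proof -
    \<comment> \<open>An edge through two members of the class would join equivalent vertices, which
      \<open>E\<close> excludes.\<close>
    have "{e \<in> edges H. y \<in> e} \<inter> {e \<in> edges H. z \<in> e} = {}"
      if "y \<in> ?q x" "z \<in> ?q x" "y \<noteq> z" for y z
    proof -
      have "(y, z) \<in> R" "(z, y) \<in> R"
        using R that unfolding equiv_def by (meson Image_singleton_iff symD transD)+
      then have "\<not> (y \<in> e \<and> z \<in> e)" if "e \<in> edges H" for e
        using E[OF that] \<open>y \<noteq> z\<close> by blast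
      then show ?thesis by blast
    qed
    then show ?thesis unfolding induced_label_def
      by (intro sum.UNION_disjoint) (use finite_subset[OF qV finV] fin in auto)
  qed
  finally show "induced_label (merge R H) ?f (?q x) = (\<Sum>y\<in>?q x. induced_label H g y)" .
qed

section \<open>The independent classes S, O and Q\<close>

context luv_pres
begin

lemma class_S_iff: "j \<in> {1..p} \<Longrightarrow> vert L j \<in> class_S p n L \<longleftrightarrow> (\<exists>\<phi>\<in>{1..n}. j = 2 * apex L \<phi> + 1)"
proof -
  assume j: "j \<in> {1..p}"
  have "vert L j = vert L (2 * apex L \<phi> + 1) \<longleftrightarrow> j = 2 * apex L \<phi> + 1" if "\<phi> \<in> {1..n}" for \<phi>
    by (rule inj_on_eq_iff[OF inj_vert j]) (use apex_bounds[OF that] in auto)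
  then show ?thesis unfolding class_S_def by blast
qed

lemma class_Q_iff: "j \<in> {1..p} \<Longrightarrow> vert L j \<in> class_Q p n L \<longleftrightarrow> even j"
  using inj_on_eq_iff[OF inj_vert] unfolding class_Q_def by blast

lemma class_O_iff:
  assumes "j \<in> {1..p}"
  shows "vert L j \<in> class_O p n L \<longleftrightarrow> odd j \<and> vert L j \<notin> class_S p n L"
proof -
  have "vert L j \<in> {vert L i | i. i \<in> {1..p} \<and> odd i} \<longleftrightarrow> odd j"
    using inj_on_eq_iff[OF inj_vert assms] assms by blast
  then show ?thesis by (simp add: class_O_def)
qed

lemma class_sub:
  "class_S p n L \<subseteq> verts (luv_graph p n L)" "class_O p n L \<subseteq> verts (luv_graph p n L)"
  "class_Q p n L \<subseteq> verts (luv_graph p n L)"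
  using apex_bounds by (fastforce simp: luv_graph_def class_S_def class_O_def class_Q_def)+

lemma class_disjoint:
  "class_S p n L \<inter> class_O p n L = {}" "class_S p n L \<inter> class_Q p n L = {}"
  "class_O p n L \<inter> class_Q p n L = {}"
proof -
  have "v \<notin> class_Q p n L" if v: "v \<in> class_S p n L \<union> class_O p n L" for v
  proof -
    obtain j where j: "j \<in> {1..p}" "v = vert L j"
      using v class_sub by (auto simp: luv_graph_def)
    then have "odd j" using v class_S_iff class_O_iff by auto
    then show ?thesis using j class_Q_iff by simp
  qed
  then show "class_S p n L \<inter> class_Q p n L = {}" "class_O p n L \<inter> class_Q p n L = {}" by auto
  show "class_S p n L \<inter> class_O p n L = {}" by (auto simp: class_O_def)
qed

lemma class_cases:
  "verts (luv_graph p n L) \<subseteq> class_S p n L \<union> class_O p n L \<union> class_Q p n L"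
proof -
  have "vert L j \<in> class_S p n L \<union> class_O p n L \<union> class_Q p n L" if "j \<in> {1..p}" for j
    using class_O_iff[OF that] class_Q_iff[OF that] by blast
  then show ?thesis unfolding luv_graph_def fst_conv by (rule image_subsetI)
qed

text \<open>Path edges join subscripts of opposite parity, so one end is in Q. Return edges join an
  apex to \<open>u_1\<close> or \<open>u_p\<close>, which \<open>apex_bounds\<close> keeps out of
  S.\<close>

lemma edge_classes:
  assumes "e \<in> edges (luv_graph p n L)"
  obtains x y where "e = {x, y}"
    "x \<in> class_S p n L \<and> y \<in> class_O p n L \<or> x \<in> class_S p n L \<union> class_O p n L \<and> y \<in> class_Q p n L"
proof -
  obtain \<phi> i where f: "\<phi> \<in> {1..n}" "i \<in> {1..Suc p}" "e = trail_edge p L \<phi> i"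
    using assms edges_eq by auto
  let ?x = "vert L (trail p L \<phi> i)" and ?y = "vert L (trail p L \<phi> (Suc i))"
  have r: "trail p L \<phi> i \<in> {1..p}" "trail p L \<phi> (Suc i) \<in> {1..p}" using trail_range f by auto
  have e: "e = {?x, ?y}" "e = {?y, ?x}" using f by (auto simp: trail_edge_def)
  consider "i \<in> {1..p - 1}" | "i = p" | "i = Suc p" using f by force
  then show thesis
  proof cases
    case 1
    then have "odd (trail p L \<phi> i + trail p L \<phi> (Suc i))" using trail_step f by blast
    then have "odd (trail p L \<phi> i) \<and> even (trail p L \<phi> (Suc i)) \<or>
      even (trail p L \<phi> i) \<and> odd (trail p L \<phi> (Suc i))" by auto
    then show thesis
      using that[OF e(1)] that[OF e(2)] class_O_iff[OF r(1)] class_O_iff[OF r(2)]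
        class_Q_iff[OF r(1)] class_Q_iff[OF r(2)] by blast
  next
    have end_O: "vert L k \<in> class_O p n L" if "k = 1 \<or> k = p" for k
    proof -
      have k: "k \<in> {1..p}" "odd k" using that p_ge odd_p by auto
      moreover have "vert L k \<notin> class_S p n L"
        using class_S_iff[OF k(1)] apex_bounds that by fastforce
      ultimately show ?thesis using class_O_iff by blast
    qed
    have apex_S: "vert L (trail p L \<phi> (Suc p)) \<in> class_S p n L"
      using f trail_Suc_p[of \<phi>] by (auto simp: class_S_def)
    {
      case 2
      have "trail p L \<phi> p = p" using trail_p f by simp
      then have "?x \<in> class_O p n L" using end_O 2 by simp
      then show thesis using that[OF e(2)] apex_S 2 by blast
    next
      case 3
      have "?y \<in> class_O p n L" using end_O 3 trail_Suc_Suc_p[of \<phi>] by simp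
      then show thesis using that[OF e(1)] apex_S 3 by blast
    }
  qed
qed

end

subsection \<open>The labeling of a disjoint union\<close>

locale luv_family =
  fixes t p n :: nat and C :: "nat \<Rightarrow> 'a luv"
  assumes family: "luv_union t p n C" and t_pos: "t \<ge> 1"
begin

abbreviation "N \<equiv> t * n"
abbreviation "H \<equiv> luv_union_graph t p n C"

lemma pres: "c \<in> {1..t} \<Longrightarrow> luv_pres p n (C c)"
  using family by (auto simp: luv_union_def luv_pres_def)

lemma odd_p: "odd p" and p_ge: "p \<ge> 9" and n_ge: "n \<ge> 2"
  using luv_pres.odd_p luv_pres.p_ge luv_pres.n_ge pres[of 1] t_pos by auto

lemma comp_disjoint:
  assumes "c \<in> {1..t}" "d \<in> {1..t}" "x \<in> verts (luv_graph p n (C c))" "x \<in> verts (luv_graph p n (C d))"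
  shows "c = d"
  using family assms unfolding luv_union_def disjoint_family_on_def by blast

lemma verts_H: "verts H = (\<Union>c\<in>{1..t}. verts (luv_graph p n (C c)))"
  and edges_H: "edges H = (\<Union>c\<in>{1..t}. edges (luv_graph p n (C c)))"
  by (simp_all add: luv_union_graph_def)

lemma finite_verts: "finite (verts H)"
  by (simp add: verts_H luv_graph_def)

text \<open>The slot \<open>(c, \<phi>, i)\<close> stands for position \<open>i\<close> on trail
  \<open>\<phi>\<close> of component \<open>c\<close>; labels are given to slots first and then
  moved to edges.\<close>

abbreviation "slots \<equiv> {1..t} \<times> {1..n} \<times> {1..Suc p}"

definition slot_edge :: "nat \<times> nat \<times> nat \<Rightarrow> 'a set" where
  "slot_edge = (\<lambda>(c, \<phi>, i). trail_edge p (C c) \<phi> i)"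

text \<open>The trails are numbered from 1 to \<open>N\<close>, component by component.\<close>

definition slot_label :: "nat \<times> nat \<times> nat \<Rightarrow> nat" where
  "slot_label = (\<lambda>(c, \<phi>, i). trail_label N p ((c - 1) * n + \<phi>) i)"

lemma slot_edge_sub:
  assumes "c \<in> {1..t}" "\<phi> \<in> {1..n}" "i \<in> {1..Suc p}"
  shows "slot_edge (c, \<phi>, i) \<subseteq> verts (luv_graph p n (C c))"
proof -
  have "trail p (C c) \<phi> i \<in> {1..p}" "trail p (C c) \<phi> (Suc i) \<in> {1..p}"
    using luv_pres.trail_range[OF pres[OF assms(1)] assms(2)] assms(3) by auto
  then show ?thesis by (auto simp: slot_edge_def luv_graph_def trail_edge_def)
qed

text \<open>Inside a component \<open>trail_edge_inj\<close> applies. Edges of different components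
  differ because they are nonempty and the components share no vertex.\<close>

lemma slot_edge_bij: "bij_betw slot_edge slots (edges H)"
proof -
  have img: "slot_edge ` slots = edges H"
  proof -
    have "slot_edge ` slots = (\<Union>c\<in>{1..t}. (\<lambda>(\<phi>, i). trail_edge p (C c) \<phi> i) ` ({1..n} \<times> {1..Suc p}))"
      by (auto simp: slot_edge_def image_iff)
    also have "\<dots> = edges H"
      unfolding edges_H using luv_pres.edges_eq[OF pres] by simp
    finally show ?thesis .
  qed
  have "inj_on slot_edge slots"
  proof (rule inj_onI)
    fix \<sigma> \<tau> assume slots: "\<sigma> \<in> slots" "\<tau> \<in> slots" "slot_edge \<sigma> = slot_edge \<tau>"
    obtain c \<phi> i d \<psi> k where \<sigma>: "\<sigma> = (c, \<phi>, i)" and \<tau>: "\<tau> = (d, \<psi>, k)"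
      by (metis prod.exhaust)
    from slots have a: "c \<in> {1..t}" "\<phi> \<in> {1..n}" "i \<in> {1..Suc p}"
        "d \<in> {1..t}" "\<psi> \<in> {1..n}" "k \<in> {1..Suc p}"
      and e: "slot_edge (c, \<phi>, i) = slot_edge (d, \<psi>, k)"
      unfolding \<sigma> \<tau> by blast+
    have "slot_edge (c, \<phi>, i) \<noteq> {}" by (simp add: slot_edge_def trail_edge_def)
    then obtain x where "x \<in> slot_edge (c, \<phi>, i)" by blast
    then have cd: "c = d"
      using comp_disjoint[OF a(1,4)] slot_edge_sub[OF a(1-3)] slot_edge_sub[OF a(4-6)] e by blast
    have "(\<phi>, i) = (\<psi>, k)"
      using inj_onD[OF luv_pres.trail_edge_inj[OF pres[OF a(1)]], of "(\<phi>, i)" "(\<psi>, k)"] a e cd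
      by (simp add: slot_edge_def)
    with cd show "\<sigma> = \<tau>" by (simp add: \<sigma> \<tau>)
  qed
  with img show ?thesis by (simp add: bij_betw_def)
qed

lemma trail_index:
  assumes "c \<in> {1..t}" "\<phi> \<in> {1..n}" shows "(c - 1) * n + \<phi> \<in> {1..N}"
proof -
  have "c \<le> t" using assms by simp
  then have "(c - 1 + 1) * n \<le> N" using assms by (intro mult_le_mono1) auto
  then show ?thesis using assms by (simp add: distrib_right)
qed

text \<open>Division by \<open>n\<close>, after lowering \<open>\<phi>\<close> by one, recovers both
  coordinates; counting gives surjectivity.\<close>

lemma trail_index_bij: "bij_betw (\<lambda>(c, \<phi>). (c - 1) * n + \<phi>) ({1..t} \<times> {1..n}) {1..N}"
proof -
  have inj: "inj_on (\<lambda>(c, \<phi>). (c - 1) * n + \<phi>) ({1..t} \<times> {1..n})"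
  proof (rule inj_onI, clarify)
    fix c \<phi> d \<psi>
    assume a: "c \<in> {1..t}" "\<phi> \<in> {1..n}" "d \<in> {1..t}" "\<psi> \<in> {1..n}"
      and e: "(c - 1) * n + \<phi> = (d - 1) * n + \<psi>"
    have div: "((c - 1) * n + (\<phi> - 1)) div n = c - 1" if "\<phi> \<in> {1..n}" for c \<phi>
      using that by (subst div_mult_self3) auto
    have "(c - 1) * n + (\<phi> - 1) = (d - 1) * n + (\<psi> - 1)"
      using e a by (metis Nat.add_diff_assoc atLeastAtMost_iff)
    then have "c - 1 = d - 1" using div[OF a(2), of c] div[OF a(4), of d] by simp
    then have "c = d" using a(1,3) by auto
    with e show "c = d \<and> \<phi> = \<psi>" by simp
  qed
  have "(\<lambda>(c, \<phi>). (c - 1) * n + \<phi>) ` ({1..t} \<times> {1..n}) \<subseteq> {1..N}"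
    using trail_index by auto
  moreover have "card ((\<lambda>(c, \<phi>). (c - 1) * n + \<phi>) ` ({1..t} \<times> {1..n})) = N"
    by (subst card_image[OF inj]) simp
  ultimately have "(\<lambda>(c, \<phi>). (c - 1) * n + \<phi>) ` ({1..t} \<times> {1..n}) = {1..N}"
    by (intro card_subset_eq) auto
  with inj show ?thesis by (simp add: bij_betw_def)
qed

lemma slot_label_bij: "bij_betw slot_label slots {1..N * Suc p}"
proof -
  let ?assoc = "\<lambda>(c, \<phi>, i). ((c, \<phi>), i)"
  have "bij_betw ?assoc slots (({1..t} \<times> {1..n}) \<times> {1..Suc p})"
    by (rule bij_betw_byWitness[where f' = "\<lambda>((c, \<phi>), i). (c, \<phi>, i)"]) auto
  moreover have "bij_betw (map_prod (\<lambda>(c, \<phi>). (c - 1) * n + \<phi>) id)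
      (({1..t} \<times> {1..n}) \<times> {1..Suc p}) ({1..N} \<times> {1..Suc p})"
    by (rule bij_betw_map_prod[OF trail_index_bij bij_betw_id])
  ultimately have "bij_betw ((\<lambda>(x, i). trail_label N p x i) \<circ>
      (map_prod (\<lambda>(c, \<phi>). (c - 1) * n + \<phi>) id \<circ> ?assoc)) slots {1..N * Suc p}"
    using trail_label_bij[OF odd_p] by (blast intro: bij_betw_trans)
  moreover have "(\<lambda>(x, i). trail_label N p x i) \<circ>
      (map_prod (\<lambda>(c, \<phi>). (c - 1) * n + \<phi>) id \<circ> ?assoc) = slot_label"
    by (auto simp: slot_label_def fun_eq_iff)
  ultimately show ?thesis by simp
qed

definition base_label :: "'a set \<Rightarrow> nat" where
  "base_label = slot_label \<circ> inv_into slots slot_edge"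

lemma finite_edges: "finite (edges H)"
  using bij_betw_finite[OF slot_edge_bij] by simp

lemma base_label_bij: "bij_betw base_label (edges H) {1..card (edges H)}"
proof -
  have "bij_betw base_label (edges H) {1..N * Suc p}"
    unfolding base_label_def
    by (rule bij_betw_trans[OF bij_betw_inv_into[OF slot_edge_bij] slot_label_bij])
  then show ?thesis using bij_betw_same_card by fastforce
qed

text \<open>The three values collect one visit from each of the \<open>n\<close> trails of a
  component; class S has one extra visit on a single trail.\<close>

definition O_hue :: nat where "O_hue = n * (N * (p + 1) + 1)"
definition S_hue :: nat where "S_hue = O_hue + (N * (p + 1) + 1 + N * (p div 2))"
definition Q_hue :: nat where "Q_hue = n * (N * p + 1)"

text \<open>Only the component of the vertex contributes, and there the sum splits into one
  \<open>trail_weight\<close> per trail. As apexes are distinct, at most one trail makes the extra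
  visit.\<close>

lemma induced_base:
  assumes c: "c \<in> {1..t}" and j: "j \<in> {1..p}"
  shows "induced_label H base_label (vert (C c) j) =
    (if odd j then O_hue else Q_hue) +
    (if vert (C c) j \<in> class_S p n (C c) then N * (p + 1) + 1 + N * (p div 2) else 0)"
proof -
  interpret luv_pres p n "C c" by (rule pres[OF c])
  let ?v = "vert (C c) j"
  let ?g = "\<lambda>d \<phi> i. if ?v \<in> slot_edge (d, \<phi>, i) then slot_label (d, \<phi>, i) else 0"
  have v: "?v \<in> verts (luv_graph p n (C c))" using j by (auto simp: luv_graph_def)
  have "induced_label H base_label ?v = (\<Sum>e\<in>edges H. if ?v \<in> e then base_label e else 0)"
    unfolding induced_label_def using finite_edges by (simp add: sum.inter_filter)
  also have "\<dots> = (\<Sum>\<tau>\<in>slots. if ?v \<in> slot_edge \<tau> then slot_label \<tau> else 0)"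
  proof (rule sum.reindex_bij_betw[OF slot_edge_bij, symmetric, THEN trans])
    show "(\<Sum>\<tau>\<in>slots. if ?v \<in> slot_edge \<tau> then base_label (slot_edge \<tau>) else 0) =
      (\<Sum>\<tau>\<in>slots. if ?v \<in> slot_edge \<tau> then slot_label \<tau> else 0)"
      using slot_edge_bij by (intro sum.cong refl) (auto simp: base_label_def bij_betw_def inv_into_f_f)
  qed
  also have "\<dots> = (\<Sum>d\<in>{1..t}. \<Sum>\<phi>\<in>{1..n}. \<Sum>i\<in>{1..Suc p}. ?g d \<phi> i)"
    by (simp only: sum.cartesian_product) (simp only: case_prod_unfold prod.collapse)
  also have "\<dots> = (\<Sum>d\<in>{1..t}. if d = c then \<Sum>\<phi>\<in>{1..n}. \<Sum>i\<in>{1..Suc p}. ?g d \<phi> i else 0)"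
  proof (rule sum.cong[OF refl])
    fix d assume d: "d \<in> {1..t}"
    have "?g d \<phi> i = 0" if "d \<noteq> c" "\<phi> \<in> {1..n}" "i \<in> {1..Suc p}" for \<phi> i
      using slot_edge_sub[OF d that(2,3)] comp_disjoint[OF c d v] that(1) by auto
    then show "(\<Sum>\<phi>\<in>{1..n}. \<Sum>i\<in>{1..Suc p}. ?g d \<phi> i) =
       (if d = c then \<Sum>\<phi>\<in>{1..n}. \<Sum>i\<in>{1..Suc p}. ?g d \<phi> i else 0)" by simp
  qed
  also have "\<dots> = (\<Sum>\<phi>\<in>{1..n}. \<Sum>i\<in>{1..Suc p}. ?g c \<phi> i)" using c by simp
  also have "\<dots> = (\<Sum>\<phi>\<in>{1..n}. (if odd j then N * (p + 1) + 1 else N * p + 1) +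
    (if j = 2 * apex (C c) \<phi> + 1 then N * (p + 1) + 1 + N * (p div 2) else 0))"
  proof (rule sum.cong[OF refl])
    fix \<phi> assume f: "\<phi> \<in> {1..n}"
    show "(\<Sum>i\<in>{1..Suc p}. ?g c \<phi> i) = (if odd j then N * (p + 1) + 1 else N * p + 1) +
    (if j = 2 * apex (C c) \<phi> + 1 then N * (p + 1) + 1 + N * (p div 2) else 0)"
      using trail_weight[OF f j trail_index[OF c f]] by (simp only: slot_edge_def slot_label_def prod.case)
  qed
  also have "\<dots> = (if odd j then O_hue else Q_hue) +
    (\<Sum>\<phi>\<in>{1..n}. if j = 2 * apex (C c) \<phi> + 1 then N * (p + 1) + 1 + N * (p div 2) else 0)"
    by (simp add: sum.distrib O_hue_def Q_hue_def)
  also have "(\<Sum>\<phi>\<in>{1..n}. if j = 2 * apex (C c) \<phi> + 1 then N * (p + 1) + 1 + N * (p div 2) else 0) =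
    (if ?v \<in> class_S p n (C c) then N * (p + 1) + 1 + N * (p div 2) else 0)"
  proof (cases "?v \<in> class_S p n (C c)")
    case True
    then obtain \<psi> where psi: "\<psi> \<in> {1..n}" "j = 2 * apex (C c) \<psi> + 1" using class_S_iff[OF j] by blast
    then have "j = 2 * apex (C c) \<phi> + 1 \<longleftrightarrow> \<phi> = \<psi>" if "\<phi> \<in> {1..n}" for \<phi>
      using inj_onD[OF inj_apex _ that psi(1)] by auto
    then have "(\<Sum>\<phi>\<in>{1..n}. if j = 2 * apex (C c) \<phi> + 1 then N * (p + 1) + 1 + N * (p div 2) else 0) =
      (\<Sum>\<phi>\<in>{1..n}. if \<phi> = \<psi> then N * (p + 1) + 1 + N * (p div 2) else 0)"
      by (intro sum.cong refl) simp
    then show ?thesis using True psi by simp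
  next
    case False
    then show ?thesis using class_S_iff[OF j] by (simp del: One_nat_def)
  qed
  finally show ?thesis .
qed

lemma induced_base_class:
  assumes c: "c \<in> {1..t}"
  shows "x \<in> class_S p n (C c) \<Longrightarrow> induced_label H base_label x = S_hue"
    and "x \<in> class_O p n (C c) \<Longrightarrow> induced_label H base_label x = O_hue"
    and "x \<in> class_Q p n (C c) \<Longrightarrow> induced_label H base_label x = Q_hue"
proof -
  interpret luv_pres p n "C c" by (rule pres[OF c])
  have vert: "\<exists>j\<in>{1..p}. x = vert (C c) j"
    if "x \<in> class_S p n (C c) \<or> x \<in> class_O p n (C c) \<or> x \<in> class_Q p n (C c)"
    using that class_sub by (auto simp: luv_graph_def)
  show "induced_label H base_label x = S_hue" if a: "x \<in> class_S p n (C c)"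
  proof -
    obtain j where j: "j \<in> {1..p}" "x = vert (C c) j" using vert a by blast
    then have "odd j" using a class_S_iff by auto
    then show ?thesis using induced_base[OF c j(1)] a j by (simp add: S_hue_def)
  qed
  show "induced_label H base_label x = O_hue" if a: "x \<in> class_O p n (C c)"
  proof -
    obtain j where j: "j \<in> {1..p}" "x = vert (C c) j" using vert a by blast
    then show ?thesis using induced_base[OF c j(1)] a class_O_iff[OF j(1)] by simp
  qed
  show "induced_label H base_label x = Q_hue" if a: "x \<in> class_Q p n (C c)"
  proof -
    obtain j where j: "j \<in> {1..p}" "x = vert (C c) j" using vert a by blast
    then show ?thesis using induced_base[OF c j(1)] a class_Q_iff[OF j(1)] class_disjoint by auto
  qed
qed

end

section \<open>The lower bound for one Luv graph\<close>

text \<open>The odd cycle \<open>u\<^sub>1 u\<^sub>2 \<dots> u\<^bsub>2a+1\<^esub>\<close> forces a third colour.\<close>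

lemma (in luv_pres) three_colours:
  assumes col: "\<And>x y. {x, y} \<in> edges (luv_graph p n L) \<Longrightarrow> h x \<noteq> h y"
  shows "3 \<le> card (h ` verts (luv_graph p n L))"
proof (rule ccontr)
  assume "\<not> ?thesis"
  then have two: "card (h ` verts (luv_graph p n L)) \<le> 2" by simp
  define k where "k j = h (vert L j)" for j
  have one: "1 \<in> {1..n}" using n_ge by simp
  have step: "k j \<noteq> k (Suc j)" if "j \<in> {1..p - 1}" for j
  proof -
    have "trail_edge p L 1 j \<in> edges (luv_graph p n L)"
      using edges_eq one that by force
    moreover have "trail_edge p L 1 j = {vert L j, vert L (Suc j)}"
      using that by (auto simp: trail_edge_def trail_def)
    ultimately show ?thesis using col by (simp add: k_def)
  qed
  have k_in: "k j \<in> h ` verts (luv_graph p n L)" if "j \<in> {1..p}" for j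
    using that by (auto simp: k_def luv_graph_def)
  \<comment> \<open>With only two colours, both neighbours of \<open>Suc j\<close> on the path take
    the colour that \<open>Suc j\<close> does not have.\<close>
  have skip: "k j = k (Suc (Suc j))" if "j \<ge> 1" "Suc (Suc j) \<le> p" for j
  proof (rule ccontr)
    assume "k j \<noteq> k (Suc (Suc j))"
    moreover have "k j \<noteq> k (Suc j)" "k (Suc j) \<noteq> k (Suc (Suc j))" using step that by auto
    ultimately have "card {k j, k (Suc j), k (Suc (Suc j))} = 3" by auto
    moreover have "{k j, k (Suc j), k (Suc (Suc j))} \<subseteq> h ` verts (luv_graph p n L)"
      using k_in that by auto
    moreover have "finite (h ` verts (luv_graph p n L))" by (simp add: luv_graph_def)
    ultimately have "3 \<le> card (h ` verts (luv_graph p n L))" using card_mono by metis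
    with two show False by simp
  qed
  have odd: "k (2 * i + 1) = k 1" if "2 * i + 1 \<le> p" for i
    using that by (induction i) (use skip in auto)
  \<comment> \<open>The edge from \<open>u_1\<close> to the apex joins two odd subscripts and so
    closes the odd cycle.\<close>
  have "luv_F p L 1 \<subseteq> edges (luv_graph p n L)" using one by (auto simp: luv_graph_def)
  then have "{vert L 1, vert L (2 * apex L 1 + 1)} \<in> edges (luv_graph p n L)"
    by (auto simp: luv_F_def)
  then have "k 1 \<noteq> k (2 * apex L 1 + 1)" using col by (simp add: k_def)
  then show False using odd[of "apex L 1"] apex_bounds[OF one] by simp
qed

subsection \<open>Merged families\<close>

text \<open>\<open>cls\<close> is left abstract so that merging along S, O and Q is treated at once;
  its independence keeps edges from collapsing.\<close>

locale luv_merged = luv_family "r * s" p n C for r s p n :: nat and C :: "nat \<Rightarrow> 'a luv" +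
  fixes cls :: "'a luv \<Rightarrow> 'a set" and m :: nat and D :: "nat \<Rightarrow> nat set" and ord :: "nat \<Rightarrow> nat \<Rightarrow> 'a"
  assumes part: "component_partition r s D"
    and ord: "\<And>c. c \<in> {1..r * s} \<Longrightarrow> bij_betw (ord c) {1..m} (cls (C c))"
    and cls_sub: "\<And>c. c \<in> {1..r * s} \<Longrightarrow> cls (C c) \<subseteq> verts (luv_graph p n (C c))"
    and cls_indep: "\<And>c e. c \<in> {1..r * s} \<Longrightarrow> e \<in> edges (luv_graph p n (C c)) \<Longrightarrow> \<not> e \<subseteq> cls (C c)"
begin

abbreviation "R \<equiv> merge_rel r m D ord (verts H)"
abbreviation "G \<equiv> merge R H"

lemma D_sub: "\<rho> \<in> {1..r} \<Longrightarrow> D \<rho> \<subseteq> {1..r * s}"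
  using part by (auto simp: component_partition_def)

lemma D_mem: "\<rho> \<in> {1..r} \<Longrightarrow> c \<in> D \<rho> \<Longrightarrow> c \<in> {1..r * s}"
  using D_sub by blast

lemma D_unique: "\<rho> \<in> {1..r} \<Longrightarrow> \<sigma> \<in> {1..r} \<Longrightarrow> c \<in> D \<rho> \<Longrightarrow> c \<in> D \<sigma> \<Longrightarrow> \<rho> = \<sigma>"
  using part unfolding component_partition_def disjoint_family_on_def by blast

lemma ord_cls: "c \<in> {1..r * s} \<Longrightarrow> k \<in> {1..m} \<Longrightarrow> ord c k \<in> cls (C c)"
  using bij_betwE[OF ord] by blast

lemma ord_verts: "c \<in> {1..r * s} \<Longrightarrow> k \<in> {1..m} \<Longrightarrow> ord c k \<in> verts (luv_graph p n (C c))"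
  using ord_cls cls_sub by blast

text \<open>Components share no vertex and each \<open>ord c\<close> is injective, so a vertex
  determines its component and its rank.\<close>

lemma ord_eq:
  assumes "c \<in> {1..r * s}" "d \<in> {1..r * s}" "k \<in> {1..m}" "l \<in> {1..m}" "ord c k = ord d l"
  shows "c = d \<and> k = l"
proof -
  have "c = d" using comp_disjoint[OF assms(1,2) ord_verts[OF assms(1,3)]] ord_verts[OF assms(2,4)] assms(5) by simp
  moreover have "inj_on (ord c) {1..m}" using ord[OF assms(1)] by (simp add: bij_betw_def)
  ultimately show ?thesis using assms by (auto dest: inj_onD)
qed

lemma relE:
  assumes "(x, y) \<in> R"
  obtains "x = y" "x \<in> verts H"
  | \<rho> c d k where "\<rho> \<in> {1..r}" "c \<in> D \<rho>" "d \<in> D \<rho>" "k \<in> {1..m}" "x = ord c k" "y = ord d k"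
  using assms unfolding merge_rel_def by blast

lemma relI: "\<rho> \<in> {1..r} \<Longrightarrow> c \<in> D \<rho> \<Longrightarrow> d \<in> D \<rho> \<Longrightarrow> k \<in> {1..m} \<Longrightarrow> (ord c k, ord d k) \<in> R"
  unfolding merge_rel_def by blast

lemma equiv_R: "equiv (verts H) R"
proof (rule equivI)
  show "R \<subseteq> verts H \<times> verts H"
  proof clarify
    fix x y assume "(x, y) \<in> R"
    then show "x \<in> verts H \<and> y \<in> verts H"
    proof (cases rule: relE)
      case (2 \<rho> c d k)
      then have "c \<in> {1..r * s}" "d \<in> {1..r * s}" using D_mem by blast+
      then show ?thesis using ord_verts 2 verts_H by blast
    qed auto
  qed
  show "refl_on (verts H) R" by (auto simp: refl_on_def merge_rel_def)
  show "sym R" by (rule symI, erule relE) (auto intro: relI simp: merge_rel_def)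
  show "trans R"
  proof (rule transI)
    fix x y z assume xy: "(x, y) \<in> R" and yz: "(y, z) \<in> R"
    from xy show "(x, z) \<in> R"
    proof (cases rule: relE)
      case 1 then show ?thesis using yz by simp
    next
      case a: (2 \<rho> c d k)
      from yz show ?thesis
      proof (cases rule: relE)
        case 1 then show ?thesis using xy by simp
      next
        case b: (2 \<sigma> c' d' l)
        \<comment> \<open>The middle vertex \<open>y\<close> has one component and one rank, so both
          pairs belong to the same set of the partition.\<close>
        have "d = c' \<and> k = l" by (rule ord_eq) (use a b D_mem in blast)+
        moreover from this have "\<rho> = \<sigma>" using a b D_unique by blast
        ultimately show ?thesis using a b relI by blast
      qed
    qed
  qed
qed

text \<open>Equivalent vertices have the same rank, so they can differ only by their
  component.\<close>

lemma rel_same_comp: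
  assumes "(x, y) \<in> R" "c \<in> {1..r * s}" "x \<in> verts (luv_graph p n (C c))" "y \<in> verts (luv_graph p n (C c))"
  shows "x = y"
  using assms(1)
proof (cases rule: relE)
  case (2 \<rho> a b k)
  then have ab: "a \<in> {1..r * s}" "b \<in> {1..r * s}" using D_mem by blast+
  then have "a = c" "b = c" using comp_disjoint ord_verts 2 assms by blast+
  with 2 show ?thesis by simp
qed

lemma rel_class:
  assumes "(x, y) \<in> R" "x \<noteq> y"
  shows "\<exists>c\<in>{1..r * s}. x \<in> cls (C c)" "\<exists>c\<in>{1..r * s}. y \<in> cls (C c)"
proof -
  obtain \<rho> c d k where "\<rho> \<in> {1..r}" "c \<in> D \<rho>" "d \<in> D \<rho>" "k \<in> {1..m}" "x = ord c k" "y = ord d k"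
    using assms by (metis relE)
  then show "\<exists>c\<in>{1..r * s}. x \<in> cls (C c)" "\<exists>c\<in>{1..r * s}. y \<in> cls (C c)"
    using D_mem ord_cls by metis+
qed

lemma class_unique:
  assumes "c \<in> {1..r * s}" "x \<in> verts (luv_graph p n (C c))" "d \<in> {1..r * s}" "x \<in> cls (C d)"
  shows "x \<in> cls (C c)"
  using comp_disjoint[OF assms(1,3,2)] cls_sub[OF assms(3)] assms(4) by blast

text \<open>Since \<open>cls\<close> is independent, some end of the edge lies outside it and is
  equivalent only to itself; the ends are named so that this one is \<open>y\<close>.\<close>

lemma edgeE:
  assumes "e \<in> edges H"
  obtains c x y where "c \<in> {1..r * s}" "e = {x, y}" "x \<in> verts (luv_graph p n (C c))"
    "y \<in> verts (luv_graph p n (C c))" "x \<noteq> y" "\<And>z. (y, z) \<in> R \<or> (z, y) \<in> R \<Longrightarrow> z = y"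
proof -
  obtain c where c: "c \<in> {1..r * s}" "e \<in> edges (luv_graph p n (C c))" using assms edges_H by auto
  interpret luv_pres p n "C c" by (rule pres[OF c(1)])
  obtain x y where xy: "e = {x, y}" "x \<in> class_S p n (C c) \<and> y \<in> class_O p n (C c) \<or>
      x \<in> class_S p n (C c) \<union> class_O p n (C c) \<and> y \<in> class_Q p n (C c)"
    using edge_classes[OF c(2)] by metis
  then have v: "x \<in> verts (luv_graph p n (C c))" "y \<in> verts (luv_graph p n (C c))" "x \<noteq> y"
    using class_sub class_disjoint by blast+
  have lone: "z = w" if "w \<notin> cls (C c)" "w \<in> verts (luv_graph p n (C c))" "(w, z) \<in> R \<or> (z, w) \<in> R" for w z
    using rel_class class_unique[OF c(1) that(2)] that by metis
  consider "x \<notin> cls (C c)" | "y \<notin> cls (C c)" using cls_indep[OF c] xy by auto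
  then show thesis
  proof cases
    case 1 then show thesis using that[OF c(1), of y x] xy v lone by (metis insert_commute)
  next
    case 2 then show thesis using that[OF c(1), of x y] xy v lone by metis
  qed
qed

text \<open>The end untouched by merging survives in the quotient and reveals the component, where
  \<open>rel_same_comp\<close> determines the other end. So merging creates no parallel
  edges.\<close>

lemma merge_inj: "inj_on ((`) (\<lambda>x. R `` {x})) (edges H)"
proof (rule inj_onI)
  fix e e' assume e: "e \<in> edges H" "e' \<in> edges H" "(\<lambda>x. R `` {x}) ` e = (\<lambda>x. R `` {x}) ` e'"
  obtain c x y where xy: "c \<in> {1..r * s}" "e = {x, y}" "x \<in> verts (luv_graph p n (C c))"
    "y \<in> verts (luv_graph p n (C c))" "\<And>z. (y, z) \<in> R \<or> (z, y) \<in> R \<Longrightarrow> z = y"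
    using edgeE[OF e(1)] by metis
  obtain d u v where uv: "d \<in> {1..r * s}" "e' = {u, v}" "u \<in> verts (luv_graph p n (C d))"
    "v \<in> verts (luv_graph p n (C d))" "\<And>z. (v, z) \<in> R \<or> (z, v) \<in> R \<Longrightarrow> z = v"
    using edgeE[OF e(2)] by metis
  have V: "x \<in> verts H" "y \<in> verts H" "u \<in> verts H" "v \<in> verts H"
    using xy uv verts_H by blast+
  note rel = eq_equiv_class_iff[OF equiv_R]
  have "{R `` {x}, R `` {y}} = {R `` {u}, R `` {v}}" using e xy uv by simp
  then consider "(x, u) \<in> R" "(y, v) \<in> R" | "(x, v) \<in> R" "(y, u) \<in> R"
    using rel V by (metis doubleton_eq_iff)
  then show "e = e'"
  proof cases
    case 1
    then have "y = v" using xy by blast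
    then have "c = d" using comp_disjoint xy uv by blast
    then have "x = u" using rel_same_comp 1 xy uv by blast
    with \<open>y = v\<close> show ?thesis using xy uv by simp
  next
    case 2
    \<comment> \<open>Each untouched end is equivalent to the other end of the other edge, hence
      equal to it.\<close>
    then have "u = y" "x = v" using xy uv by blast+
    then show ?thesis using xy uv by auto
  qed
qed

lemma class_single:
  assumes "c \<in> {1..r * s}" "x \<in> verts (luv_graph p n (C c))" "x \<notin> cls (C c)"
  shows "R `` {x} = {x}"
proof -
  have "x \<in> verts H" using assms verts_H by blast
  then have "(x, x) \<in> R" by (auto simp: merge_rel_def)
  moreover have "y = x" if "(x, y) \<in> R" for y
    using rel_class[OF that] class_unique[OF assms(1,2)] assms(3) by blast
  ultimately show ?thesis by blast
qed

text \<open>This turns a sum over an equivalence class into a sum over the components in one set of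
  the partition.\<close>

lemma class_merged:
  assumes "c \<in> {1..r * s}" "x \<in> cls (C c)"
  obtains \<rho> k where "\<rho> \<in> {1..r}" "k \<in> {1..m}" "R `` {x} = (\<lambda>d. ord d k) ` D \<rho>"
    "inj_on (\<lambda>d. ord d k) (D \<rho>)"
proof -
  obtain k where k: "k \<in> {1..m}" "x = ord c k"
    using ord[OF assms(1)] assms(2) unfolding bij_betw_def by blast
  obtain \<rho> where \<rho>: "\<rho> \<in> {1..r}" "c \<in> D \<rho>"
    using part assms(1) unfolding component_partition_def by blast
  have "y \<in> (\<lambda>d. ord d k) ` D \<rho>" if "(x, y) \<in> R" for y
    using that
  proof (cases rule: relE)
    case 1 then show ?thesis using k \<rho> by blast
  next
    case (2 \<sigma> c' d l)
    have "c = c' \<and> k = l" by (rule ord_eq) (use 2 k assms D_mem in \<open>blast intro: trans sym\<close>)+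
    moreover from this have "\<rho> = \<sigma>" using 2 \<rho> D_unique by blast
    ultimately show ?thesis using 2 by blast
  qed
  then have "R `` {x} = (\<lambda>d. ord d k) ` D \<rho>" using relI[OF \<rho> _ k(1)] k(2) by blast
  moreover have "inj_on (\<lambda>d. ord d k) (D \<rho>)"
    by (rule inj_onI) (use ord_eq D_sub[OF \<rho>(1)] k(1) in blast)
  ultimately show thesis using that \<rho> k by blast
qed

text \<open>\<open>merge_labeling\<close> adds the base values over each equivalence class: a
  singleton outside \<open>cls\<close>, and \<open>s\<close> vertices of equal value inside
  it.\<close>

lemma merged_label:
  obtains f where "bij_betw f (edges G) {1..card (edges G)}"
    "\<And>c x. c \<in> {1..r * s} \<Longrightarrow> x \<in> verts (luv_graph p n (C c)) \<Longrightarrow> x \<notin> cls (C c) \<Longrightarrow>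
       induced_label G f (R `` {x}) = induced_label H base_label x"
    "\<And>c x \<kappa>. c \<in> {1..r * s} \<Longrightarrow> x \<in> cls (C c) \<Longrightarrow>
       (\<And>d y. d \<in> {1..r * s} \<Longrightarrow> y \<in> cls (C d) \<Longrightarrow> induced_label H base_label y = \<kappa>) \<Longrightarrow>
       induced_label G f (R `` {x}) = s * \<kappa>"
proof -
  have E: "\<exists>x y. e = {x, y} \<and> x \<in> verts H \<and> y \<in> verts H \<and> (x, y) \<notin> R" if e: "e \<in> edges H" for e
  proof -
    obtain c x y where "c \<in> {1..r * s}" "e = {x, y}" "x \<in> verts (luv_graph p n (C c))"
      "y \<in> verts (luv_graph p n (C c))" "x \<noteq> y"
      using edgeE[OF e] by metis
    then show ?thesis using rel_same_comp verts_H by blast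
  qed
  obtain f where f: "bij_betw f (edges G) {1..card (edges G)}"
    "\<And>x. x \<in> verts H \<Longrightarrow> induced_label G f (R `` {x}) = (\<Sum>y\<in>R `` {x}. induced_label H base_label y)"
    using merge_labeling[OF finite_verts finite_edges equiv_R E merge_inj base_label_bij] by blast
  show thesis
  proof (rule that[OF f(1)])
    fix c x assume a: "c \<in> {1..r * s}" "x \<in> verts (luv_graph p n (C c))" "x \<notin> cls (C c)"
    then have "x \<in> verts H" using verts_H by blast
    then show "induced_label G f (R `` {x}) = induced_label H base_label x"
      using f(2)[of x] class_single[OF a] by simp
  next
    fix c x \<kappa> assume a: "c \<in> {1..r * s}" "x \<in> cls (C c)"
      and \<kappa>: "\<And>d y. d \<in> {1..r * s} \<Longrightarrow> y \<in> cls (C d) \<Longrightarrow> induced_label H base_label y = \<kappa>"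
    obtain \<rho> k where \<rho>: "\<rho> \<in> {1..r}" "k \<in> {1..m}" "R `` {x} = (\<lambda>d. ord d k) ` D \<rho>"
      "inj_on (\<lambda>d. ord d k) (D \<rho>)"
      using class_merged[OF a] by blast
    have "x \<in> verts H" using a cls_sub verts_H by blast
    then have "induced_label G f (R `` {x}) = (\<Sum>d\<in>D \<rho>. induced_label H base_label (ord d k))"
      using f(2)[of x] \<rho>(3,4) by (simp add: sum.reindex)
    also have "\<dots> = (\<Sum>d\<in>D \<rho>. \<kappa>)"
      using \<kappa> D_mem[OF \<rho>(1)] \<rho>(2) ord_cls by (intro sum.cong refl) metis
    also have "\<dots> = s * \<kappa>" using part \<rho> by (simp add: component_partition_def)
    finally show "induced_label G f (R `` {x}) = s * \<kappa>" .
  qed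
qed

lemma edges_G: "{R `` {x}, R `` {y}} \<in> edges G" if "{x, y} \<in> edges H"
  using that by (auto simp: merge_def)

text \<open>Pulled back along the quotient map, the induced labels properly colour the first
  component, so \<open>three_colours\<close> applies.\<close>

lemma chi_la_ge:
  assumes "local_antimagic G f" shows "3 \<le> card (induced_label G f ` verts G)"
proof -
  have one: "1 \<in> {1..r * s}" using t_pos by simp
  interpret luv_pres p n "C 1" by (rule pres[OF one])
  have "3 \<le> card ((\<lambda>x. induced_label G f (R `` {x})) ` verts (luv_graph p n (C 1)))"
  proof (rule three_colours)
    fix x y assume "{x, y} \<in> edges (luv_graph p n (C 1))"
    then have "{x, y} \<in> edges H" using edges_H one by blast
    then show "induced_label G f (R `` {x}) \<noteq> induced_label G f (R `` {y})"
      using edges_G assms by (simp add: local_antimagic_def)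
  qed
  also have "\<dots> \<le> card (induced_label G f ` verts G)"
  proof (rule card_mono)
    show "finite (induced_label G f ` verts G)"
      using finite_verts by (simp add: merge_def quotient_def)
    show "(\<lambda>x. induced_label G f (R `` {x})) ` verts (luv_graph p n (C 1)) \<subseteq> induced_label G f ` verts G"
    proof (rule image_subsetI)
      fix x assume "x \<in> verts (luv_graph p n (C 1))"
      then have "x \<in> verts H" using verts_H one by blast
      then have "R `` {x} \<in> verts G" by (simp add: merge_def quotientI)
      then show "induced_label G f (R `` {x}) \<in> induced_label G f ` verts G" by (rule imageI)
    qed
  qed
  finally show ?thesis .
qed

text \<open>Every edge of \<open>G\<close> comes from an edge between different classes of a Luv
  graph, so distinct class values make \<open>f\<close> local antimagic; \<open>chi_la_ge\<close>
  gives minimality.\<close>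

lemma chi_la_eq_3:
  assumes f: "bij_betw f (edges G) {1..card (edges G)}"
    and S: "\<And>c x. c \<in> {1..r * s} \<Longrightarrow> x \<in> class_S p n (C c) \<Longrightarrow> induced_label G f (R `` {x}) = a"
    and O: "\<And>c x. c \<in> {1..r * s} \<Longrightarrow> x \<in> class_O p n (C c) \<Longrightarrow> induced_label G f (R `` {x}) = b"
    and Q: "\<And>c x. c \<in> {1..r * s} \<Longrightarrow> x \<in> class_Q p n (C c) \<Longrightarrow> induced_label G f (R `` {x}) = d"
    and distinct: "a \<noteq> b" "a \<noteq> d" "b \<noteq> d"
  shows "chi_la G = 3"
proof -
  have "induced_label G f X \<noteq> induced_label G f Y" if XY: "{X, Y} \<in> edges G" for X Y
  proof -
    obtain x y where xy: "{X, Y} = {R `` {x}, R `` {y}}" "{x, y} \<in> edges H"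
      using XY by (auto simp: merge_def)
    then obtain c where c: "c \<in> {1..r * s}" "{x, y} \<in> edges (luv_graph p n (C c))"
      using edges_H by auto
    interpret luv_pres p n "C c" by (rule pres[OF c(1)])
    obtain u v where "{x, y} = {u, v}" "u \<in> class_S p n (C c) \<and> v \<in> class_O p n (C c) \<or>
        u \<in> class_S p n (C c) \<union> class_O p n (C c) \<and> v \<in> class_Q p n (C c)"
      using edge_classes[OF c(2)] by metis
    then have "induced_label G f (R `` {x}) \<noteq> induced_label G f (R `` {y})"
      using S[OF c(1)] O[OF c(1)] Q[OF c(1)] distinct by (metis UnE doubleton_eq_iff)
    then show ?thesis using xy(1) by (metis doubleton_eq_iff)
  qed
  then have lam: "local_antimagic G f" using f by (simp add: local_antimagic_def)
  have "induced_label G f ` verts G \<subseteq> {a, b, d}"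
  proof (rule image_subsetI)
    fix X assume "X \<in> verts G"
    then obtain x where x: "x \<in> verts H" "X = R `` {x}" by (auto simp: merge_def quotient_def)
    then obtain c where c: "c \<in> {1..r * s}" "x \<in> verts (luv_graph p n (C c))" using verts_H by auto
    then have "x \<in> class_S p n (C c) \<union> class_O p n (C c) \<union> class_Q p n (C c)"
      using luv_pres.class_cases[OF pres[OF c(1)]] by blast
    then show "induced_label G f X \<in> {a, b, d}"
      using S[OF c(1)] O[OF c(1)] Q[OF c(1)] x(2) by blast
  qed
  then have "card (induced_label G f ` verts G) \<le> card {a, b, d}" by (intro card_mono) auto
  also have "\<dots> = 3" using distinct by simp
  finally have "card (induced_label G f ` verts G) = 3" using chi_la_ge[OF lam] by simp
  then show ?thesis unfolding chi_la_def
    using lam chi_la_ge by (intro Least_equality) force+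
qed

end

section \<open>Comparison of the values and the three families\<close>

text \<open>Merging multiplies one of the three values by \<open>s \<ge> 2\<close>. Doubling any of
  them already lifts it above the largest, \<open>S_hue\<close>, so the values stay
  distinct.\<close>

lemma (in luv_family) hues:
  "n \<ge> 2" "Q_hue < O_hue" "O_hue < S_hue" "S_hue < 2 * O_hue" "S_hue < 2 * Q_hue"
proof -
  show n: "n \<ge> 2" by (rule n_ge)
  have N: "N > 0" using t_pos n by simp
  show "Q_hue < O_hue" "O_hue < S_hue" using N n by (auto simp: O_hue_def Q_hue_def S_hue_def)
  obtain a where a: "n = a + 2" using n by (metis add.commute le_Suc_ex)
  obtain q where q: "p = 2 * q + 1" using odd_p by (auto elim: oddE)
  have q4: "q \<ge> 4" using p_ge q by simp
  \<comment> \<open>The surplus of \<open>S_hue\<close> over \<open>O_hue\<close> is less than two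
    ordinary visits, and \<open>O_hue\<close> counts \<open>n \<ge> 2\<close> of them.\<close>
  have "N * (p div 2) \<le> N * (p + 1)" by (rule mult_le_mono2) simp
  moreover have "2 * (N * (p + 1) + 1) \<le> O_hue" unfolding O_hue_def using n by (rule mult_le_mono1)
  ultimately show "S_hue < 2 * O_hue" by (simp add: S_hue_def)
  \<comment> \<open>This compares the multiples of \<open>N\<close> in \<open>S_hue\<close> and
    \<open>2 * Q_hue\<close>: the right side exceeds the left by \<open>2 * a * q + q - 2\<close>.
    The remaining constants are \<open>n + 1 < 2 * n\<close>.\<close>
  have "(n + 1) * (p + 1) + p div 2 \<le> 2 * n * p"
    using q4 by (simp add: a q algebra_simps)
  then have "N * ((n + 1) * (p + 1) + p div 2) \<le> N * (2 * n * p)" by (rule mult_le_mono2)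
  then have "(n + 1) * (N * (p + 1)) + N * (p div 2) \<le> 2 * (n * (N * p))"
    by (simp add: algebra_simps)
  then show "S_hue < 2 * Q_hue" using n
    by (simp add: S_hue_def O_hue_def Q_hue_def distrib_left)
qed

lemma (in luv_pres) class_indep:
  assumes "e \<in> edges (luv_graph p n L)"
  shows "\<not> e \<subseteq> class_S p n L" "\<not> e \<subseteq> class_O p n L" "\<not> e \<subseteq> class_Q p n L"
proof -
  obtain x y where "e = {x, y}"
    "x \<in> class_S p n L \<and> y \<in> class_O p n L \<or> x \<in> class_S p n L \<union> class_O p n L \<and> y \<in> class_Q p n L"
    using edge_classes[OF assms] by metis
  then show "\<not> e \<subseteq> class_S p n L" "\<not> e \<subseteq> class_O p n L" "\<not> e \<subseteq> class_Q p n L"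
    using class_disjoint by auto
qed

lemma merged_familyE:
  assumes "G \<in> merged_family cls m r s p n" "r \<ge> 1" "s \<ge> 1"
    and cls: "cls \<in> {class_S p n, class_O p n, class_Q p n}"
  obtains C D ord where "luv_merged r s p n C cls m D ord"
    "G = merge (merge_rel r m D ord (verts (luv_union_graph (r * s) p n C))) (luv_union_graph (r * s) p n C)"
proof -
  obtain C D ord where *: "luv_union (r * s) p n C" "component_partition r s D"
      "\<And>c. c \<in> {1..r * s} \<Longrightarrow> bij_betw (ord c) {1..m} (cls (C c))"
    and G: "G = merge (merge_rel r m D ord (verts (luv_union_graph (r * s) p n C))) (luv_union_graph (r * s) p n C)"
    using assms(1) unfolding merged_family_def by blast
  have "luv_family (r * s) p n C" using * assms(2,3) by unfold_locales auto
  then interpret luv_family "r * s" p n C .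
  have "luv_merged r s p n C cls m D ord"
  proof
    fix c assume c: "c \<in> {1..r * s}"
    show "cls (C c) \<subseteq> verts (luv_graph p n (C c))"
      using cls luv_pres.class_sub[OF pres[OF c]] by auto
    show "\<not> e \<subseteq> cls (C c)" if "e \<in> edges (luv_graph p n (C c))" for e
      using cls luv_pres.class_indep[OF pres[OF c] that] by auto
  qed (use * in auto)
  with G show thesis using that by blast
qed

text \<open>\<open>w\<close> is the factor by which merging multiplies the induced label on class
  \<open>K\<close>: \<open>s\<close> on the merged class and \<open>1\<close> on a class left
  alone.\<close>

definition (in luv_merged) weight :: "('a luv \<Rightarrow> 'a set) \<Rightarrow> nat \<Rightarrow> bool" where
  "weight K w \<longleftrightarrow> w = s \<and> (\<forall>c\<in>{1..r * s}. K (C c) = cls (C c)) \<or>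
     w = 1 \<and> (\<forall>c\<in>{1..r * s}. K (C c) \<inter> cls (C c) = {})"

text \<open>Whichever class is merged, the claim is thereby reduced to the distinctness of three
  numbers.\<close>

lemma (in luv_merged) chi_la_weighted:
  assumes w: "weight (class_S p n) a" "weight (class_O p n) b" "weight (class_Q p n) d"
    and "a * S_hue \<noteq> b * O_hue" "a * S_hue \<noteq> d * Q_hue" "b * O_hue \<noteq> d * Q_hue"
  shows "chi_la G = 3"
proof -
  obtain f where f: "bij_betw f (edges G) {1..card (edges G)}"
    "\<And>c x. c \<in> {1..r * s} \<Longrightarrow> x \<in> verts (luv_graph p n (C c)) \<Longrightarrow> x \<notin> cls (C c) \<Longrightarrow>
       induced_label G f (R `` {x}) = induced_label H base_label x"
    "\<And>c x \<kappa>. c \<in> {1..r * s} \<Longrightarrow> x \<in> cls (C c) \<Longrightarrow>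
       (\<And>d y. d \<in> {1..r * s} \<Longrightarrow> y \<in> cls (C d) \<Longrightarrow> induced_label H base_label y = \<kappa>) \<Longrightarrow>
       induced_label G f (R `` {x}) = s * \<kappa>"
    using merged_label by blast
  have val: "induced_label G f (R `` {x}) = v * \<kappa>"
    if "weight K v" "c \<in> {1..r * s}" "x \<in> K (C c)"
      and sub: "K (C c) \<subseteq> verts (luv_graph p n (C c))"
      and \<kappa>: "\<And>d y. d \<in> {1..r * s} \<Longrightarrow> y \<in> K (C d) \<Longrightarrow> induced_label H base_label y = \<kappa>"
    for K v \<kappa> c x
  proof -
    from that(1) consider "v = s" "\<And>c. c \<in> {1..r * s} \<Longrightarrow> K (C c) = cls (C c)"
      | "v = 1" "\<And>c. c \<in> {1..r * s} \<Longrightarrow> K (C c) \<inter> cls (C c) = {}"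
      unfolding weight_def by blast
    then show ?thesis
    proof cases
      case 1
      have "induced_label G f (R `` {x}) = s * \<kappa>"
        by (rule f(3)[OF that(2)]) (use 1(2) that(2,3) \<kappa> in blast)+
      with 1(1) show ?thesis by simp
    next
      case 2
      have "induced_label G f (R `` {x}) = induced_label H base_label x"
        by (rule f(2)[OF that(2)]) (use 2(2)[OF that(2)] that(3) sub in blast)+
      with 2(1) \<kappa>[OF that(2,3)] show ?thesis by simp
    qed
  qed
  note sub = luv_pres.class_sub[OF pres]
  show ?thesis
    using val[OF w(1) _ _ sub(1) induced_base_class(1)] val[OF w(2) _ _ sub(2) induced_base_class(2)]
      val[OF w(3) _ _ sub(3) induced_base_class(3)]
    by (intro chi_la_eq_3[OF f(1), where a = "a * S_hue" and b = "b * O_hue" and d = "d * Q_hue"] assms)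
qed

theorem theorem2p4:
  fixes n r s p :: nat and G :: "'a set graph"
  assumes "n \<ge> 2" and "r \<ge> 1" and "s \<ge> 2" and "p \<ge> 9" and "odd p"
    and "G \<in> GL1 r s p n \<union> GL2 r s p n \<union> GL3 r s p n"
  shows "chi_la G = 3"
proof -
  have s1: "s \<ge> 1" using assms(3) by simp
  \<comment> \<open>The value of the merged class at least doubles, so by \<open>hues\<close> it
    exceeds those of the other two classes.\<close>
  have twice: "2 * h \<le> s * h" for h by (rule mult_le_mono1[OF assms(3)])
  consider "G \<in> GL1 r s p n" | "G \<in> GL2 r s p n" | "G \<in> GL3 r s p n" using assms(6) by blast
  then show ?thesis
  proof cases
    case 1
    then obtain C D ord where "luv_merged r s p n C (class_S p n) n D ord"
      and G: "G = merge (merge_rel r n D ord (verts (luv_union_graph (r * s) p n C)))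
        (luv_union_graph (r * s) p n C)"
      unfolding GL1_def using merged_familyE[OF _ assms(2) s1] by blast
    then interpret M: luv_merged r s p n C "class_S p n" "n" D ord by simp
    have "M.weight (class_S p n) s" "M.weight (class_O p n) 1" "M.weight (class_Q p n) 1"
      using luv_pres.class_disjoint[OF M.pres] by (auto simp: M.weight_def Int_commute)
    then show ?thesis
      unfolding G by (rule M.chi_la_weighted) (use M.hues twice[of M.S_hue] in linarith)+
  next
    case 2
    then obtain C D ord where "luv_merged r s p n C (class_O p n) ((p + 1 - 2 * n) div 2) D ord"
      and G: "G = merge (merge_rel r ((p + 1 - 2 * n) div 2) D ord (verts (luv_union_graph (r * s) p n C)))
        (luv_union_graph (r * s) p n C)"
      unfolding GL2_def using merged_familyE[OF _ assms(2) s1] by blast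
    then interpret M: luv_merged r s p n C "class_O p n" "(p + 1 - 2 * n) div 2" D ord by simp
    have "M.weight (class_S p n) 1" "M.weight (class_O p n) s" "M.weight (class_Q p n) 1"
      using luv_pres.class_disjoint[OF M.pres] by (auto simp: M.weight_def Int_commute)
    then show ?thesis
      unfolding G by (rule M.chi_la_weighted) (use M.hues twice[of M.O_hue] in linarith)+
  next
    case 3
    then obtain C D ord where "luv_merged r s p n C (class_Q p n) ((p - 1) div 2) D ord"
      and G: "G = merge (merge_rel r ((p - 1) div 2) D ord (verts (luv_union_graph (r * s) p n C)))
        (luv_union_graph (r * s) p n C)"
      unfolding GL3_def using merged_familyE[OF _ assms(2) s1] by blast
    then interpret M: luv_merged r s p n C "class_Q p n" "(p - 1) div 2" D ord by simp
    have "M.weight (class_S p n) 1" "M.weight (class_O p n) 1" "M.weight (class_Q p n) s"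
      using luv_pres.class_disjoint[OF M.pres] by (auto simp: M.weight_def Int_commute)
    then show ?thesis
      unfolding G by (rule M.chi_la_weighted) (use M.hues twice[of M.Q_hue] in linarith)+
  qed
qed

end
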